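(* Let $r=\frac{e^2-1}{e^2+1}$ and let $\mathcal{F}=\alpha_F+\beta_F$ be the Funk–Finsler metric on $\mathbb{D}_K(1)=\{x\in\mathbb{R}^2:|x|<r\}$. Define $$\phi=\frac{(1-r^2)\big[(1-|x|^2)|\xi|^2+2\langle x,\xi\rangle^2\big]}{(r^2-|x|^2)(1-|x|^2)^2},$$ $$\psi=\frac{2(1-r^2)\langle x,\xi\rangle}{(1-|x|^2)^3(r^2-|x|^2)^2}\Big[(1-|x|^2)|\xi|^2(3r^2-2|x|^2-1)-2\langle x,\xi\rangle^2(1+|x|^2-2r^2)\Big],$$ $$\tau_k=\frac{(1-r^2)\big(x^k|\xi|^2-\xi^k\langle x,\xi\rangle\big)}{\mathcal{F}(r^2-|x|^2)^2(1-|x|^2)}.$$ Then the Riemann curvature of $\mathcal{F}$ is $$R^i_k=-\big(\delta^i_k\alpha_F^2-\alpha_F(\alpha_F)_{\xi^k}\xi^i\big)+\Big[3\Big(\frac{\phi}{2\mathcal{F}}\Big)^2-\frac{\psi}{2\mathcal{F}}\Big]\Big(\delta^i_k-\frac{\mathcal{F}_{\xi^k}}{\mathcal{F}}\xi^i\Big)+\tau_k\xi^i,$$ and the Ricci curvature $\mathrm{Ric}=R^i_i$ and flag curvature $\mathbf{K}$ satisfy $$\mathrm{Ric}=\mathbf{K}\,\mathcal{F}^2=3\Big(\frac{\phi}{2\mathcal{F}}\Big)^2-\frac{\psi}{2\mathcal{F}}-\alpha_F^2.$$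
   Context: $\alpha_F(x,\xi)=\frac{\sqrt{(r^2-|x|^2)|\xi|^2+\langle x,\xi\rangle^2}}{r^2-|x|^2}$, $\beta_F(x,\xi)=\frac{(1-r^2)\langle x,\xi\rangle}{(r^2-|x|^2)(1-|x|^2)}$, $\mathcal{F}=\alpha_F+\beta_F$; subscripts $\xi^k$ denote partial derivatives in $\xi^k$. Spray coefficients: $G^i=\frac14g^{i\ell}\{[F^2]_{x^k\xi^\ell}\xi^k-[F^2]_{x^\ell}\}$ with $g_{ij}=\frac12\partial_{\xi^i}\partial_{\xi^j}F^2$. Riemann curvature: $R^i_k=2\frac{\partial G^i}{\partial x^k}-\xi^j\frac{\partial^2G^i}{\partial x^j\partial\xi^k}+2G^j\frac{\partial^2G^i}{\partial\xi^j\partial\xi^k}-\frac{\partial G^i}{\partial\xi^j}\frac{\partial G^j}{\partial\xi^k}$. Ricci curvature $\mathrm{Ric}=R^i_i$. The flag curvature $\mathbf{K}(x,\xi)$ of a 2-dimensional Finsler metric is the function with $\mathrm{Ric}=\mathbf{K}F^2$ (equivalently $\mathbf{K}=g_\xi(R_\xi u,u)/(g_\xi(\xi,\xi)g_\xi(u,u)-g_\xi(\xi,u)^2)$ for any $u$ not parallel to $\xi$). *)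

theory Defs
  imports "HOL-Analysis.Analysis"
begin

definition rK :: real where
  "rK = (exp 2 - 1) / (exp 2 + 1)"

definition alphaF :: "real^2 \<Rightarrow> real^2 \<Rightarrow> real" where
  "alphaF x v = sqrt ((rK^2 - (norm x)^2) * (norm v)^2 + (x \<bullet> v)^2) / (rK^2 - (norm x)^2)"

definition betaF :: "real^2 \<Rightarrow> real^2 \<Rightarrow> real" where
  "betaF x v = (1 - rK^2) * (x \<bullet> v) / ((rK^2 - (norm x)^2) * (1 - (norm x)^2))"

definition FF :: "real^2 \<Rightarrow> real^2 \<Rightarrow> real" where
  "FF x v = alphaF x v + betaF x v"

definition pdx :: "2 \<Rightarrow> (real^2 \<Rightarrow> real^2 \<Rightarrow> real) \<Rightarrow> real^2 \<Rightarrow> real^2 \<Rightarrow> real" where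
  "pdx k f x v = deriv (\<lambda>t. f (x + t *\<^sub>R axis k 1) v) 0"

definition pdxi :: "2 \<Rightarrow> (real^2 \<Rightarrow> real^2 \<Rightarrow> real) \<Rightarrow> real^2 \<Rightarrow> real^2 \<Rightarrow> real" where
  "pdxi k f x v = deriv (\<lambda>t. f x (v + t *\<^sub>R axis k 1)) 0"

definition sqF :: "(real^2 \<Rightarrow> real^2 \<Rightarrow> real) \<Rightarrow> real^2 \<Rightarrow> real^2 \<Rightarrow> real" where
  "sqF F x v = (F x v)^2"

definition fund_g :: "(real^2 \<Rightarrow> real^2 \<Rightarrow> real) \<Rightarrow> 2 \<Rightarrow> 2 \<Rightarrow> real^2 \<Rightarrow> real^2 \<Rightarrow> real" where
  "fund_g F i j x v = 1/2 * pdxi i (pdxi j (sqF F)) x v"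

definition ginv :: "(real^2 \<Rightarrow> real^2 \<Rightarrow> real) \<Rightarrow> real^2 \<Rightarrow> real^2 \<Rightarrow> real^2^2" where
  "ginv F x v = matrix_inv (\<chi> i j. fund_g F i j x v)"

definition spray :: "(real^2 \<Rightarrow> real^2 \<Rightarrow> real) \<Rightarrow> 2 \<Rightarrow> real^2 \<Rightarrow> real^2 \<Rightarrow> real" where
  "spray F i x v = 1/4 * (\<Sum>l\<in>UNIV. ginv F x v $ i $ l *
      ((\<Sum>k\<in>UNIV. pdxi l (pdx k (sqF F)) x v * v $ k) - pdx l (sqF F) x v))"

definition riemann :: "(real^2 \<Rightarrow> real^2 \<Rightarrow> real) \<Rightarrow> 2 \<Rightarrow> 2 \<Rightarrow> real^2 \<Rightarrow> real^2 \<Rightarrow> real" where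
  "riemann F i k x v =
     2 * pdx k (spray F i) x v
     - (\<Sum>j\<in>UNIV. v $ j * pdx j (pdxi k (spray F i)) x v)
     + 2 * (\<Sum>j\<in>UNIV. spray F j x v * pdxi j (pdxi k (spray F i)) x v)
     - (\<Sum>j\<in>UNIV. pdxi j (spray F i) x v * pdxi k (spray F j) x v)"

definition ricci :: "(real^2 \<Rightarrow> real^2 \<Rightarrow> real) \<Rightarrow> real^2 \<Rightarrow> real^2 \<Rightarrow> real" where
  "ricci F x v = (\<Sum>i\<in>UNIV. riemann F i i x v)"

text \<open>Flag curvature of a 2-dimensional Finsler metric: Ric = K F^2.\<close>

definition flag_curv :: "(real^2 \<Rightarrow> real^2 \<Rightarrow> real) \<Rightarrow> real^2 \<Rightarrow> real^2 \<Rightarrow> real" where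
  "flag_curv F x v = ricci F x v / (F x v)^2"

end

theory Submission
  imports Defs
begin

text \<open>
  Everything follows from the identity \<open>F\<^bsub>x\<^sup>k\<^esub> = (P F)\<^bsub>\<xi>\<^sup>k\<^esub>\<close>, where \<open>P = p + \<phi> / (2 F)\<close> and
  \<open>p = \<langle>x,\<xi>\<rangle> / (r\<^sup>2 - |x|\<^sup>2)\<close> is the projective factor of the Klein metric \<open>\<alpha>\<close>. It implies Rapcsak's
  equation, so the spray is \<open>G\<^sup>i = P \<xi>\<^sup>i\<close>. Since the second derivatives \<open>F\<^bsub>x\<^sup>j x\<^sup>k\<^esub>\<close> are symmetric,
  \<open>H = P F\<close> satisfies \<open>\<xi>\<^sup>j H\<^bsub>x\<^sup>j \<xi>\<^sup>k\<^esub> = 2 H\<^bsub>x\<^sup>k\<^esub>\<close>, and with Euler's relations the curvature collapses to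
  \<open>R\<^sup>i\<^sub>k = (P\<^sup>2 - \<xi>\<^sup>j P\<^bsub>x\<^sup>j\<^esub>) (\<delta>\<^sup>i\<^sub>k - \<xi>\<^sup>i F\<^bsub>\<xi>\<^sup>k\<^esub> / F)\<close>. The first factor contains \<open>- \<alpha>\<^sup>2\<close>, and
  trading its share of \<open>R\<^sup>i\<^sub>k\<close> for the curvature of \<open>\<alpha>\<close> leaves \<open>\<tau>\<^sub>k \<xi>\<^sup>i\<close> with
  \<open>F \<tau>\<^sub>k = \<alpha>\<^sup>2 F\<^bsub>\<xi>\<^sup>k\<^esub> - F \<alpha> \<alpha>\<^bsub>\<xi>\<^sup>k\<^esub>\<close>.
\<close>

section \<open>Iterated directional derivatives\<close>

definition dir_deriv :: "'a::real_normed_vector \<Rightarrow> ('a \<Rightarrow> real) \<Rightarrow> 'a \<Rightarrow> real" where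
  "dir_deriv u f p = deriv (\<lambda>t. f (p + t *\<^sub>R u)) 0"

lemma has_derivative_imp_dir_deriv:
  assumes "(f has_derivative f') (at p)"
  shows "dir_deriv u f p = f' u"
proof -
  have "((\<lambda>t. p + t *\<^sub>R u) has_derivative (\<lambda>t. t *\<^sub>R u)) (at 0)"
    by (auto intro!: derivative_eq_intros)
  then have "((\<lambda>t. f (p + t *\<^sub>R u)) has_derivative (\<lambda>t. f' (t *\<^sub>R u))) (at 0)"
    by (rule has_derivative_compose) (simp add: assms)
  then have "((\<lambda>t. f (p + t *\<^sub>R u)) has_real_derivative f' u) (at 0)"
    by (rule has_derivative_imp_has_field_derivative)
      (simp add: linear_scale[OF has_derivative_linear[OF assms]])
  then show ?thesis
    unfolding dir_deriv_def by (rule DERIV_imp_deriv)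
qed

lemma differentiable_has_derivative_dir_deriv:
  assumes "f differentiable (at p)"
  shows "(f has_derivative (\<lambda>u. dir_deriv u f p)) (at p)"
  using assms has_derivative_imp_dir_deriv[of f _ p] unfolding differentiable_def by fastforce

lemma eventually_line_in_open:
  fixes p u :: "'a::real_normed_vector"
  assumes "open S" "p \<in> S"
  shows "\<forall>\<^sub>F t in nhds 0. p + t *\<^sub>R u \<in> S"
proof -
  have "((\<lambda>t. p + t *\<^sub>R u) \<longlongrightarrow> p + 0 *\<^sub>R u) (nhds 0)"
    by (intro tendsto_intros filterlim_ident)
  then show ?thesis
    using assms by (auto dest: topological_tendstoD)
qed

lemma dir_deriv_cong:
  assumes "open S" "p \<in> S" "\<And>q. q \<in> S \<Longrightarrow> f q = g q"
  shows "dir_deriv u f p = dir_deriv u g p"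
  unfolding dir_deriv_def
  using eventually_mono[OF eventually_line_in_open[OF assms(1,2)] assms(3)]
  by (intro deriv_cong_ev) simp_all

primrec Ck_on :: "nat \<Rightarrow> 'a::real_normed_vector set \<Rightarrow> ('a \<Rightarrow> real) \<Rightarrow> bool" where
  "Ck_on 0 S f \<longleftrightarrow> continuous_on S f"
| "Ck_on (Suc n) S f \<longleftrightarrow> (\<forall>p\<in>S. f differentiable (at p)) \<and> (\<forall>u. Ck_on n S (dir_deriv u f))"

definition smooth_on :: "'a::real_normed_vector set \<Rightarrow> ('a \<Rightarrow> real) \<Rightarrow> bool" where
  "smooth_on S f \<longleftrightarrow> (\<forall>n. Ck_on n S f)"

lemma Ck_on_cong:
  assumes "open S" "\<And>q. q \<in> S \<Longrightarrow> f q = g q" "Ck_on n S f"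
  shows "Ck_on n S g"
  using assms(2,3)
proof (induction n arbitrary: f g)
  case 0
  then show ?case by (metis Ck_on.simps(1) continuous_on_cong)
next
  case (Suc n)
  have "g differentiable (at p)" if "p \<in> S" for p
    using Suc.prems that has_derivative_transform_within_open[OF _ \<open>open S\<close> that]
    unfolding differentiable_def Ck_on.simps by metis
  moreover have "Ck_on n S (dir_deriv u g)" for u
  proof (rule Suc.IH)
    show "dir_deriv u f q = dir_deriv u g q" if "q \<in> S" for q
      using dir_deriv_cong[OF \<open>open S\<close> that Suc.prems(1)] .
    show "Ck_on n S (dir_deriv u f)"
      using Suc.prems(2) by simp
  qed
  ultimately show ?case by simp
qed

lemma Ck_on_SucI:
  assumes "open S" "\<And>p. p \<in> S \<Longrightarrow> (f has_derivative f' p) (at p)"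
    and "\<And>u. Ck_on n S (\<lambda>p. f' p u)"
  shows "Ck_on (Suc n) S f"
proof -
  have "Ck_on n S (dir_deriv u f)" for u
    using has_derivative_imp_dir_deriv[OF assms(2)]
    by (intro Ck_on_cong[OF assms(1) _ assms(3)]) simp
  then show ?thesis
    using assms(2) by (auto simp: differentiable_def)
qed

lemma Ck_on_Suc_has_derivative:
  assumes "Ck_on (Suc n) S f" "p \<in> S"
  shows "(f has_derivative (\<lambda>u. dir_deriv u f p)) (at p)"
  using assms by (simp add: differentiable_has_derivative_dir_deriv)

lemma Ck_on_Suc_imp_Ck_on: "Ck_on (Suc n) S f \<Longrightarrow> Ck_on n S f"
proof (induction n arbitrary: f)
  case 0
  then show ?case
    by (auto intro!: continuous_at_imp_continuous_on differentiable_imp_continuous_within)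
qed auto

lemma Ck_on_const: "open S \<Longrightarrow> Ck_on n S (\<lambda>p. c)"
proof (induction n arbitrary: c)
  case (Suc n)
  then show ?case by (intro Ck_on_SucI[where f' = "\<lambda>p u. 0"]) auto
qed simp

lemma Ck_on_bounded_linear: "open S \<Longrightarrow> bounded_linear L \<Longrightarrow> Ck_on n S L"
proof (cases n)
  case (Suc k)
  assume "open S" "bounded_linear L"
  then show ?thesis unfolding Suc
    by (intro Ck_on_SucI[where f' = "\<lambda>p. L"] Ck_on_const)
      (auto intro: bounded_linear_imp_has_derivative)
qed (simp add: linear_continuous_on)

lemma Ck_on_add: "open S \<Longrightarrow> Ck_on n S f \<Longrightarrow> Ck_on n S g \<Longrightarrow> Ck_on n S (\<lambda>p. f p + g p)"
proof (induction n arbitrary: f g)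
  case (Suc n)
  show ?case
  proof (rule Ck_on_SucI[OF \<open>open S\<close>])
    show "((\<lambda>p. f p + g p) has_derivative (\<lambda>u. dir_deriv u f p + dir_deriv u g p)) (at p)"
      if "p \<in> S" for p
      using Suc.prems that by (intro has_derivative_add Ck_on_Suc_has_derivative) auto
  qed (use Suc in auto)
qed (auto intro: continuous_on_add)

lemma Ck_on_mult: "open S \<Longrightarrow> Ck_on n S f \<Longrightarrow> Ck_on n S g \<Longrightarrow> Ck_on n S (\<lambda>p. f p * g p)"
proof (induction n arbitrary: f g)
  case (Suc n)
  then have "Ck_on n S f" "Ck_on n S g"
    by (blast intro: Ck_on_Suc_imp_Ck_on)+
  show ?case
  proof (rule Ck_on_SucI[OF \<open>open S\<close>])
    show "((\<lambda>p. f p * g p) has_derivative (\<lambda>u. f p * dir_deriv u g p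
        + dir_deriv u f p * g p)) (at p)"
      if "p \<in> S" for p
      using Suc.prems that by (intro has_derivative_mult Ck_on_Suc_has_derivative) auto
    show "Ck_on n S (\<lambda>p. f p * dir_deriv u g p + dir_deriv u f p * g p)" for u
      using Suc \<open>Ck_on n S f\<close> \<open>Ck_on n S g\<close> by (intro Ck_on_add Suc.IH) auto
  qed
qed (auto intro: continuous_on_mult)

lemma Ck_on_inverse:
  "open S \<Longrightarrow> Ck_on n S f \<Longrightarrow> (\<And>p. p \<in> S \<Longrightarrow> f p \<noteq> 0) \<Longrightarrow> Ck_on n S (\<lambda>p. inverse (f p))"
proof (induction n)
  case (Suc n)
  then have inverse: "Ck_on n S (\<lambda>p. inverse (f p))"
    using Ck_on_Suc_imp_Ck_on by blast
  show ?case
  proof (rule Ck_on_SucI[OF \<open>open S\<close>])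
    show "((\<lambda>p. inverse (f p)) has_derivative
        (\<lambda>u. (- 1) * (inverse (f p) * dir_deriv u f p * inverse (f p)))) (at p)"
      if "p \<in> S" for p
      using Deriv.has_derivative_inverse[OF Suc.prems(3)
          Ck_on_Suc_has_derivative[OF Suc.prems(2)]] that by simp
    show "Ck_on n S (\<lambda>p. (- 1) * (inverse (f p) * dir_deriv u f p * inverse (f p)))" for u
      using Suc.prems inverse by (intro Ck_on_mult Ck_on_const) auto
  qed
qed (auto intro: continuous_on_inverse)

lemma Ck_on_sqrt:
  "open S \<Longrightarrow> Ck_on n S f \<Longrightarrow> (\<And>p. p \<in> S \<Longrightarrow> f p > 0) \<Longrightarrow> Ck_on n S (\<lambda>p. sqrt (f p))"
proof (induction n)
  case (Suc n)
  then have sqrt: "Ck_on n S (\<lambda>p. sqrt (f p))"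
    using Ck_on_Suc_imp_Ck_on by blast
  have nonzero: "sqrt (f p) \<noteq> 0" if "p \<in> S" for p
    using Suc.prems(3)[OF that] by simp
  show ?case
  proof (rule Ck_on_SucI[OF \<open>open S\<close>])
    show "((\<lambda>p. sqrt (f p)) has_derivative (\<lambda>u. dir_deriv u f p * (inverse (sqrt (f p)) / 2)))
        (at p)"
      if "p \<in> S" for p
      by (intro has_derivative_real_sqrt Ck_on_Suc_has_derivative[OF Suc.prems(2)] Suc.prems(3)
          that)
    show "Ck_on n S (\<lambda>p. dir_deriv u f p * (inverse (sqrt (f p)) / 2))" for u
      unfolding divide_inverse using Suc.prems(1,2) sqrt nonzero
      by (intro Ck_on_mult Ck_on_inverse Ck_on_const) auto
  qed
qed (auto intro: continuous_on_real_sqrt)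

lemma smooth_on_dir_deriv: "smooth_on S f \<Longrightarrow> smooth_on S (dir_deriv u f)"
  unfolding smooth_on_def by (metis Ck_on.simps(2))

lemma smooth_on_has_derivative:
  "smooth_on S f \<Longrightarrow> p \<in> S \<Longrightarrow> (f has_derivative (\<lambda>u. dir_deriv u f p)) (at p)"
  unfolding smooth_on_def by (blast intro: Ck_on_Suc_has_derivative)

lemma smooth_on_continuous_on: "smooth_on S f \<Longrightarrow> continuous_on S f"
  unfolding smooth_on_def by (metis Ck_on.simps(1))

lemma smooth_on_cong: "open S \<Longrightarrow> smooth_on S f \<Longrightarrow> (\<And>q. q \<in> S \<Longrightarrow> f q = g q) \<Longrightarrow> smooth_on S g"
  unfolding smooth_on_def by (metis Ck_on_cong)

lemma smooth_on_const: "open S \<Longrightarrow> smooth_on S (\<lambda>p. c)"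
  by (simp add: smooth_on_def Ck_on_const)

lemma smooth_on_bounded_linear: "open S \<Longrightarrow> bounded_linear L \<Longrightarrow> smooth_on S L"
  by (simp add: smooth_on_def Ck_on_bounded_linear)

lemma smooth_on_add: "open S \<Longrightarrow> smooth_on S f \<Longrightarrow> smooth_on S g \<Longrightarrow> smooth_on S (\<lambda>p. f p + g p)"
  by (simp add: smooth_on_def Ck_on_add)

lemma smooth_on_mult: "open S \<Longrightarrow> smooth_on S f \<Longrightarrow> smooth_on S g \<Longrightarrow> smooth_on S (\<lambda>p. f p * g p)"
  by (simp add: smooth_on_def Ck_on_mult)

lemma smooth_on_sqrt:
  "open S \<Longrightarrow> smooth_on S f \<Longrightarrow> (\<And>p. p \<in> S \<Longrightarrow> f p > 0) \<Longrightarrow> smooth_on S (\<lambda>p. sqrt (f p))"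
  by (simp add: smooth_on_def Ck_on_sqrt)

lemma smooth_on_diff: "open S \<Longrightarrow> smooth_on S f \<Longrightarrow> smooth_on S g \<Longrightarrow> smooth_on S (\<lambda>p. f p - g p)"
  using smooth_on_add[of S f "\<lambda>p. - 1 * g p"] smooth_on_mult[OF _ smooth_on_const] by fastforce

lemma smooth_on_divide:
  "open S \<Longrightarrow> smooth_on S f \<Longrightarrow> smooth_on S g \<Longrightarrow> (\<And>p. p \<in> S \<Longrightarrow> g p \<noteq> 0)
    \<Longrightarrow> smooth_on S (\<lambda>p. f p / g p)"
  unfolding divide_inverse smooth_on_def by (auto intro!: Ck_on_mult Ck_on_inverse)

lemma smooth_on_power: "open S \<Longrightarrow> smooth_on S f \<Longrightarrow> smooth_on S (\<lambda>p. f p ^ n)"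
  by (induction n) (auto intro: smooth_on_const smooth_on_mult)

lemma smooth_on_sum:
  "open S \<Longrightarrow> (\<And>i. i \<in> I \<Longrightarrow> smooth_on S (f i)) \<Longrightarrow> smooth_on S (\<lambda>p. \<Sum>i\<in>I. f i p)"
  by (induction I rule: infinite_finite_induct) (auto intro: smooth_on_const smooth_on_add)

lemma smooth_on_inner:
  fixes L M :: "'a::real_normed_vector \<Rightarrow> 'b::euclidean_space"
  assumes "open S" "bounded_linear L" "bounded_linear M"
  shows "smooth_on S (\<lambda>p. L p \<bullet> M p)"
proof -
  have "smooth_on S (\<lambda>p. \<Sum>b\<in>Basis. (L p \<bullet> b) * (M p \<bullet> b))"
    using assms by (intro smooth_on_sum smooth_on_mult smooth_on_bounded_linear)
      (auto intro: bounded_linear_inner_left_comp)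
  then show ?thesis by (simp only: euclidean_inner[symmetric])
qed

lemma dir_deriv_linear: "smooth_on S f \<Longrightarrow> p \<in> S \<Longrightarrow> linear (\<lambda>u. dir_deriv u f p)"
  by (metis has_derivative_linear smooth_on_has_derivative)

lemma dir_deriv_const [simp]: "dir_deriv u (\<lambda>q. c) p = 0"
  by (simp add: has_derivative_imp_dir_deriv[OF has_derivative_const])

lemma dir_deriv_add:
  "p \<in> S \<Longrightarrow> smooth_on S f \<Longrightarrow> smooth_on S g
    \<Longrightarrow> dir_deriv u (\<lambda>q. f q + g q) p = dir_deriv u f p + dir_deriv u g p"
  by (intro has_derivative_imp_dir_deriv has_derivative_add smooth_on_has_derivative)

lemma dir_deriv_mult:
  "p \<in> S \<Longrightarrow> smooth_on S f \<Longrightarrow> smooth_on S g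
    \<Longrightarrow> dir_deriv u (\<lambda>q. f q * g q) p = f p * dir_deriv u g p + dir_deriv u f p * g p"
  by (rule has_derivative_imp_dir_deriv[OF has_derivative_mult])
    (auto intro: smooth_on_has_derivative)

lemma dir_deriv_bounded_linear: "bounded_linear L \<Longrightarrow> dir_deriv u L p = L u"
  by (rule has_derivative_imp_dir_deriv) (rule bounded_linear_imp_has_derivative)

lemma dir_deriv_sum:
  "p \<in> S \<Longrightarrow> (\<And>i. i \<in> I \<Longrightarrow> smooth_on S (f i))
    \<Longrightarrow> dir_deriv u (\<lambda>q. \<Sum>i\<in>I. f i q) p = (\<Sum>i\<in>I. dir_deriv u (f i) p)"
  by (intro has_derivative_imp_dir_deriv has_derivative_sum smooth_on_has_derivative)

lemma dir_deriv_mvt: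
  assumes "convex S" "p \<in> S" "p + u \<in> S" "\<And>q. q \<in> S \<Longrightarrow> f differentiable (at q)"
  shows "\<exists>q\<in>S. f (p + u) - f p = dir_deriv u f q"
proof -
  have segment: "p + t *\<^sub>R u \<in> S" if "0 \<le> t" "t \<le> 1" for t
    using convexD[OF assms(1-3), of "1 - t" t] that by (simp add: algebra_simps)
  have "((\<lambda>t. f (p + t *\<^sub>R u)) has_real_derivative dir_deriv u f (p + t *\<^sub>R u)) (at t)"
    if "0 \<le> t" "t \<le> 1" for t
  proof -
    note f = differentiable_has_derivative_dir_deriv[OF assms(4)[OF segment[OF that]]]
    have "((\<lambda>t. p + t *\<^sub>R u) has_derivative (\<lambda>s. s *\<^sub>R u)) (at t)"
      by (auto intro!: derivative_eq_intros)
    from has_derivative_compose[OF this f] show ?thesis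
      by (rule has_derivative_imp_has_field_derivative)
        (simp add: linear_scale[OF has_derivative_linear[OF f]])
  qed
  then have "\<exists>t>0. t < 1 \<and> f (p + 1 *\<^sub>R u) - f (p + 0 *\<^sub>R u) = (1 - 0) * dir_deriv u f (p + t *\<^sub>R u)"
    by (intro MVT2) auto
  then obtain t where "0 < t" "t < 1" "f (p + u) - f p = dir_deriv u f (p + t *\<^sub>R u)"
    by auto
  then show ?thesis using segment by auto
qed

lemma second_difference_mvt:
  assumes "smooth_on S f" "convex B" "B \<subseteq> S"
    and "p \<in> B" "p + u \<in> B" "p + w \<in> B" "p + u + w \<in> B"
  shows "\<exists>q\<in>B. f (p + u + w) - f (p + u) - (f (p + w) - f p) = dir_deriv w (dir_deriv u f) q"
proof -
  let ?B' = "{q \<in> B. q + w \<in> B}"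
  have differentiable: "g differentiable (at q)" if "smooth_on S g" "q \<in> B" for g q
    using smooth_on_has_derivative[OF that(1)] that(2) assms(3)
    unfolding differentiable_def by blast
  have shifted: "((\<lambda>q. f (q + w)) has_derivative (\<lambda>v. dir_deriv v f (q + w))) (at q)"
    if "q + w \<in> B" for q
  proof -
    have "((\<lambda>q. q + w) has_derivative (\<lambda>v. v)) (at q)"
      by (auto intro!: derivative_eq_intros)
    from has_derivative_compose[OF this smooth_on_has_derivative[OF assms(1)]] show ?thesis
      using that assms(3) by blast
  qed
  have difference: "((\<lambda>q. f (q + w) - f q)
      has_derivative (\<lambda>v. dir_deriv v f (q + w) - dir_deriv v f q)) (at q)"
    if "q \<in> ?B'" for q
    using that assms(3)
    by (intro has_derivative_diff shifted smooth_on_has_derivative[OF assms(1)]) auto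
  have "convex ?B'"
  proof (rule convexI)
    fix x y and a b :: real
    assume convex_combination: "x \<in> ?B'" "y \<in> ?B'" "0 \<le> a" "0 \<le> b" "a + b = 1"
    then have "a *\<^sub>R x + b *\<^sub>R y + w = a *\<^sub>R (x + w) + b *\<^sub>R (y + w)"
      by (simp add: algebra_simps flip: scaleR_add_left)
    with convex_combination show "a *\<^sub>R x + b *\<^sub>R y \<in> ?B'"
      using convexD[OF assms(2)] by auto
  qed
  then have "\<exists>q\<in>?B'. f (p + u + w) - f (p + u) - (f (p + w) - f p)
      = dir_deriv u (\<lambda>q. f (q + w) - f q) q"
    using assms difference by (intro dir_deriv_mvt) (auto simp: differentiable_def)
  then obtain q where q: "q \<in> ?B'"
    "f (p + u + w) - f (p + u) - (f (p + w) - f p) = dir_deriv u f (q + w) - dir_deriv u f q"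
    using has_derivative_imp_dir_deriv[OF difference] by auto
  then obtain q' where "q' \<in> B" "dir_deriv u f (q + w) - dir_deriv u f q
      = dir_deriv w (dir_deriv u f) q'"
    using dir_deriv_mvt[OF assms(2), of q w "dir_deriv u f"]
        differentiable[OF smooth_on_dir_deriv[OF assms(1)]]
    by auto
  with q show ?thesis by auto
qed

lemma dir_deriv_dir_deriv_scaleR:
  assumes "open S" "smooth_on S f" "p \<in> S"
  shows "dir_deriv (h *\<^sub>R w) (dir_deriv (h *\<^sub>R u) f) p = h * h * dir_deriv w (dir_deriv u f) p"
proof -
  have scale: "dir_deriv (h *\<^sub>R v) g q = h * dir_deriv v g q" if "smooth_on S g" "q \<in> S" for g v q
    using linear_scale[OF dir_deriv_linear[OF that]] by simp
  have "dir_deriv w (dir_deriv (h *\<^sub>R u) f) p = dir_deriv w (\<lambda>q. h * dir_deriv u f q) p"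
    using scale[OF assms(2)] by (intro dir_deriv_cong[OF assms(1,3)])
  also have "\<dots> = h * dir_deriv w (dir_deriv u f) p"
    by (simp add: dir_deriv_mult[OF assms(3) smooth_on_const[OF assms(1)]
        smooth_on_dir_deriv[OF assms(2)]])
  finally show ?thesis
    using scale assms(2,3) by (simp add: smooth_on_dir_deriv)
qed

text \<open>Both mixed derivatives are attained near \<open>p\<close> by the same second difference quotient.\<close>

lemma mixed_dir_derivs_meet_in_ball:
  assumes "open S" "smooth_on S f" "\<epsilon> > 0" "ball p \<epsilon> \<subseteq> S"
  shows "\<exists>q\<in>ball p \<epsilon>. \<exists>q'\<in>ball p \<epsilon>. dir_deriv u (dir_deriv w f) q = dir_deriv w (dir_deriv u f) q'"
proof -
  define h where "h = \<epsilon> / (norm u + norm w + 1)"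
  have "norm u + norm w + 1 > 0" by (simp add: add_nonneg_pos)
  then have "h > 0" "h * (norm u + norm w) < \<epsilon>"
    using \<open>\<epsilon> > 0\<close> by (simp_all add: h_def pos_divide_less_eq algebra_simps)
  then have small: "norm (s *\<^sub>R u + t *\<^sub>R w) < \<epsilon>" if "\<bar>s\<bar> \<le> h" "\<bar>t\<bar> \<le> h" for s t
    using norm_triangle_ineq[of "s *\<^sub>R u" "t *\<^sub>R w"] mult_right_mono[OF that(1), of "norm u"]
      mult_right_mono[OF that(2), of "norm w"] by (simp add: algebra_simps)
  have corner: "p + (s *\<^sub>R u + t *\<^sub>R w) \<in> ball p \<epsilon>" if "\<bar>s\<bar> \<le> h" "\<bar>t\<bar> \<le> h" for s t
    using small[OF that] unfolding mem_ball dist_commute[of p] by (simp add: dist_norm)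
  have corners: "p \<in> ball p \<epsilon>" "p + h *\<^sub>R u \<in> ball p \<epsilon>" "p + h *\<^sub>R w \<in> ball p \<epsilon>"
    "p + h *\<^sub>R u + h *\<^sub>R w \<in> ball p \<epsilon>" "p + h *\<^sub>R w + h *\<^sub>R u \<in> ball p \<epsilon>"
    using corner[of 0 0] corner[of h 0] corner[of 0 h] corner[of h h] \<open>h > 0\<close>
    by (simp_all add: algebra_simps)
  obtain q where q: "q \<in> ball p \<epsilon>" "f (p + h *\<^sub>R w + h *\<^sub>R u) - f (p + h *\<^sub>R w)
      - (f (p + h *\<^sub>R u) - f p)
      = dir_deriv (h *\<^sub>R u) (dir_deriv (h *\<^sub>R w) f) q"
    using second_difference_mvt[OF assms(2) convex_ball assms(4) corners(1,3,2,5)] by blast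
  obtain q' where q': "q' \<in> ball p \<epsilon>" "f (p + h *\<^sub>R u + h *\<^sub>R w) - f (p + h *\<^sub>R u)
      - (f (p + h *\<^sub>R w) - f p)
      = dir_deriv (h *\<^sub>R w) (dir_deriv (h *\<^sub>R u) f) q'"
    using second_difference_mvt[OF assms(2) convex_ball assms(4) corners(1,2,3,4)] by blast
  have "dir_deriv (h *\<^sub>R u) (dir_deriv (h *\<^sub>R w) f) q = dir_deriv (h *\<^sub>R w) (dir_deriv (h *\<^sub>R u) f) q'"
    unfolding q(2)[symmetric] q'(2)[symmetric] by (simp add: algebra_simps)
  then have "dir_deriv u (dir_deriv w f) q = dir_deriv w (dir_deriv u f) q'"
    using q(1) q'(1) assms(4) \<open>h > 0\<close>
    by (simp add: dir_deriv_dir_deriv_scaleR[OF assms(1,2)] subset_iff)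
  with q(1) q'(1) show ?thesis by blast
qed

theorem dir_deriv_commute:
  assumes "open S" "smooth_on S f" "p \<in> S"
  shows "dir_deriv u (dir_deriv w f) p = dir_deriv w (dir_deriv u f) p"
    (is "?uw p = ?wu p")
proof (rule ccontr)
  assume neq: "?uw p \<noteq> ?wu p"
  have tendsto: "(?uw \<longlongrightarrow> ?uw p) (nhds p)" "(?wu \<longlongrightarrow> ?wu p) (nhds p)"
    using smooth_on_continuous_on[OF smooth_on_dir_deriv[OF smooth_on_dir_deriv[OF assms(2)]]]
        assms(1,3)
    by (simp_all add: continuous_on_eq_continuous_at isCont_def tendsto_at_iff_tendsto_nhds)
  define d where "d = dist (?uw p) (?wu p) / 2"
  have "d > 0" using neq by (simp add: d_def)
  have "\<forall>\<^sub>F q in nhds p. q \<in> S \<and> dist (?uw q) (?uw p) < d \<and> dist (?wu q) (?wu p) < d"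
    using assms(1,3)
    by (intro eventually_conj eventually_nhds_in_open tendstoD[OF _ \<open>d > 0\<close>] tendsto)
  then obtain \<epsilon> where "\<epsilon> > 0"
    and near: "\<And>q. q \<in> ball p \<epsilon> \<Longrightarrow> q \<in> S \<and> dist (?uw q) (?uw p) < d \<and> dist (?wu q) (?wu p) < d"
    unfolding eventually_nhds_metric by (auto simp: dist_commute)
  then obtain q q' where q: "q \<in> ball p \<epsilon>" "q' \<in> ball p \<epsilon>" "?uw q = ?wu q'"
    using mixed_dir_derivs_meet_in_ball[OF assms(1,2)] by (metis subsetI)
  then have "dist (?uw q) (?uw p) < d" "dist (?uw q) (?wu p) < d"
    using near[OF q(1)] near[OF q(2)] q(3) by auto
  then show False
    unfolding d_def using dist_triangle3[of "?uw p" "?wu p" "?uw q"] by simp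
qed

lemma dir_deriv_eq_sum_Basis:
  fixes f :: "'a::euclidean_space \<Rightarrow> real"
  assumes "smooth_on S f" "p \<in> S"
  shows "dir_deriv u f p = (\<Sum>b\<in>Basis. (u \<bullet> b) * dir_deriv b f p)"
proof -
  note linear = dir_deriv_linear[OF assms]
  have "dir_deriv u f p = dir_deriv (\<Sum>b\<in>Basis. (u \<bullet> b) *\<^sub>R b) f p"
    by (simp add: euclidean_representation)
  also have "\<dots> = (\<Sum>b\<in>Basis. (u \<bullet> b) * dir_deriv b f p)"
    by (simp add: linear_sum[OF linear] linear_scale[OF linear])
  finally show ?thesis .
qed

lemma smooth_on_dir_deriv_linear_field:
  fixes f :: "'a::euclidean_space \<Rightarrow> real"
  assumes "open S" "smooth_on S f" "bounded_linear L"
  shows "smooth_on S (\<lambda>q. dir_deriv (L q) f q)"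
proof (rule smooth_on_cong[OF assms(1)])
  show "smooth_on S (\<lambda>q. \<Sum>b\<in>Basis. (L q \<bullet> b) * dir_deriv b f q)"
    by (intro smooth_on_sum smooth_on_mult smooth_on_dir_deriv[OF assms(2)] assms(1)
        smooth_on_bounded_linear[OF _ bounded_linear_inner_left_comp[OF assms(3)]])
qed (simp add: dir_deriv_eq_sum_Basis[OF assms(2)])

lemma dir_deriv_linear_field:
  fixes f :: "'a::euclidean_space \<Rightarrow> real"
  assumes "open S" "smooth_on S f" "bounded_linear L" "p \<in> S"
  shows "dir_deriv w (\<lambda>q. dir_deriv (L q) f q) p = dir_deriv (L w) f p
      + dir_deriv (L p) (dir_deriv w f) p"
proof -
  note coordinate = bounded_linear_inner_left_comp[OF assms(3)]
  note smooth = smooth_on_bounded_linear[OF assms(1) coordinate] smooth_on_dir_deriv[OF assms(2)]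
  have "dir_deriv w (\<lambda>q. dir_deriv (L q) f q) p
      = dir_deriv w (\<lambda>q. \<Sum>b\<in>Basis. (L q \<bullet> b) * dir_deriv b f q) p"
    using assms by (intro dir_deriv_cong[OF assms(1,4)] dir_deriv_eq_sum_Basis)
  also have "\<dots> = (\<Sum>b\<in>Basis. (L p \<bullet> b) * dir_deriv w (dir_deriv b f) p
      + (L w \<bullet> b) * dir_deriv b f p)"
    by (simp only: dir_deriv_sum[OF assms(4) smooth_on_mult[OF assms(1) smooth]]
        dir_deriv_mult[OF assms(4) smooth] dir_deriv_bounded_linear[OF coordinate])
  also have "\<dots> = (\<Sum>b\<in>Basis. (L p \<bullet> b) * dir_deriv b (dir_deriv w f) p)
      + (\<Sum>b\<in>Basis. (L w \<bullet> b) * dir_deriv b f p)"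
    by (simp only: sum.distrib dir_deriv_commute[OF assms(1,2,4)])
  also have "\<dots> = dir_deriv (L w) f p + dir_deriv (L p) (dir_deriv w f) p"
    by (simp add: dir_deriv_eq_sum_Basis[OF assms(2,4), of "L w"]
        dir_deriv_eq_sum_Basis[OF smooth(2) assms(4), of "L p"])
  finally show ?thesis .
qed

section \<open>Calculus on the tangent bundle\<close>

abbreviation base_deriv :: "'a::euclidean_space \<Rightarrow> ('a \<times> 'a \<Rightarrow> real) \<Rightarrow> 'a \<times> 'a \<Rightarrow> real" where
  "base_deriv e \<equiv> dir_deriv (e, 0)"

abbreviation fibre_deriv :: "'a::euclidean_space \<Rightarrow> ('a \<times> 'a \<Rightarrow> real) \<Rightarrow> 'a \<times> 'a \<Rightarrow> real" where
  "fibre_deriv e \<equiv> dir_deriv (0, e)"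

text \<open>In coordinates, \<open>\<xi>\<^sup>k \<partial>/\<partial>x\<^sup>k\<close> and \<open>\<xi>\<^sup>k \<partial>/\<partial>\<xi>\<^sup>k\<close>.\<close>

definition flat_spray :: "('a::euclidean_space \<times> 'a \<Rightarrow> real) \<Rightarrow> 'a \<times> 'a \<Rightarrow> real" where
  "flat_spray f p = base_deriv (snd p) f p"

definition liouville :: "('a::euclidean_space \<times> 'a \<Rightarrow> real) \<Rightarrow> 'a \<times> 'a \<Rightarrow> real" where
  "liouville f p = fibre_deriv (snd p) f p"

definition homogeneous_on :: "('a::euclidean_space \<times> 'a) set \<Rightarrow> real \<Rightarrow> ('a \<times> 'a \<Rightarrow> real) \<Rightarrow> bool" where
  "homogeneous_on S m f \<longleftrightarrow> (\<forall>p\<in>S. liouville f p = m * f p)"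

lemma bounded_linear_flat_spray_field: "bounded_linear (\<lambda>p. (snd p, 0))"
  by (intro bounded_linear_Pair bounded_linear_snd bounded_linear_zero)

lemma bounded_linear_liouville_field: "bounded_linear (\<lambda>p. (0, snd p))"
  by (intro bounded_linear_Pair bounded_linear_snd bounded_linear_zero)

lemma smooth_on_flat_spray: "open S \<Longrightarrow> smooth_on S f \<Longrightarrow> smooth_on S (flat_spray f)"
  unfolding flat_spray_def[abs_def]
  by (rule smooth_on_dir_deriv_linear_field[OF _ _ bounded_linear_flat_spray_field])

lemma fibre_deriv_flat_spray:
  assumes "open S" "smooth_on S f" "p \<in> S"
  shows "fibre_deriv e (flat_spray f) p = base_deriv e f p + flat_spray (fibre_deriv e f) p"
  using dir_deriv_linear_field[OF assms(1,2) bounded_linear_flat_spray_field assms(3), of "(0, e)"]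
  by (simp add: flat_spray_def[abs_def])

lemma fibre_deriv_liouville:
  assumes "open S" "smooth_on S f" "p \<in> S"
  shows "fibre_deriv e (liouville f) p = fibre_deriv e f p + liouville (fibre_deriv e f) p"
  using dir_deriv_linear_field[OF assms(1,2) bounded_linear_liouville_field assms(3), of "(0, e)"]
  by (simp add: liouville_def[abs_def])

lemma base_deriv_liouville:
  assumes "open S" "smooth_on S f" "p \<in> S"
  shows "base_deriv e (liouville f) p = liouville (base_deriv e f) p"
  using dir_deriv_linear_field[OF assms(1,2) bounded_linear_liouville_field assms(3), of "(e, 0)"]
    linear_0[OF dir_deriv_linear[OF assms(2,3)]]
  by (simp add: liouville_def[abs_def] zero_prod_def)

lemma homogeneous_onI:
  assumes "\<And>x v c. (x, v) \<in> S \<Longrightarrow> c > 0 \<Longrightarrow> f (x, c *\<^sub>R v) = c ^ m * f (x, v)"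
  shows "homogeneous_on S (of_nat m) f"
  unfolding homogeneous_on_def
proof
  fix p assume "p \<in> S"
  obtain x v where p: "p = (x, v)" by (cases p)
  have "\<forall>\<^sub>F t in nhds 0. t \<in> {-1::real<..}"
    by (rule eventually_nhds_in_open) auto
  then have "\<forall>\<^sub>F t in nhds 0. f (p + t *\<^sub>R (0, v)) = (1 + t) ^ m * f p"
  proof eventually_elim
    case (elim t)
    then show ?case
      using assms[of x v "1 + t"] \<open>p \<in> S\<close> by (simp add: p scaleR_add_left)
  qed
  moreover have "((\<lambda>t. (1 + t) ^ m * f p) has_real_derivative of_nat m * f p) (at 0)"
    by (auto intro!: derivative_eq_intros)
  ultimately have "((\<lambda>t. f (p + t *\<^sub>R (0, v))) has_real_derivative of_nat m * f p) (at 0)"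
    by (simp add: DERIV_cong_ev)
  then show "liouville f p = of_nat m * f p"
    by (simp add: liouville_def dir_deriv_def p DERIV_imp_deriv)
qed

lemma homogeneous_on_base_deriv:
  assumes "open S" "smooth_on S f" "homogeneous_on S m f"
  shows "homogeneous_on S m (base_deriv e f)"
  unfolding homogeneous_on_def
proof
  fix p assume "p \<in> S"
  have "base_deriv e (liouville f) p = base_deriv e (\<lambda>q. m * f q) p"
    using assms(3) by (intro dir_deriv_cong[OF assms(1) \<open>p \<in> S\<close>]) (simp add: homogeneous_on_def)
  then show "liouville (base_deriv e f) p = m * base_deriv e f p"
    using base_deriv_liouville[OF assms(1,2) \<open>p \<in> S\<close>, of e]
      dir_deriv_mult[OF \<open>p \<in> S\<close> smooth_on_const[OF assms(1)] assms(2)] by simp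
qed

lemma homogeneous_on_fibre_deriv:
  assumes "open S" "smooth_on S f" "homogeneous_on S m f"
  shows "homogeneous_on S (m - 1) (fibre_deriv e f)"
  unfolding homogeneous_on_def
proof
  fix p assume "p \<in> S"
  have "fibre_deriv e (liouville f) p = fibre_deriv e (\<lambda>q. m * f q) p"
    using assms(3) by (intro dir_deriv_cong[OF assms(1) \<open>p \<in> S\<close>]) (simp add: homogeneous_on_def)
  then show "liouville (fibre_deriv e f) p = (m - 1) * fibre_deriv e f p"
    using fibre_deriv_liouville[OF assms(1,2) \<open>p \<in> S\<close>, of e]
      dir_deriv_mult[OF \<open>p \<in> S\<close> smooth_on_const[OF assms(1)] assms(2)]
    by (simp add: left_diff_distrib)
qed

lemma homogeneous_on_mult:
  assumes "smooth_on S f" "smooth_on S g" "homogeneous_on S m f" "homogeneous_on S n g"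
  shows "homogeneous_on S (m + n) (\<lambda>p. f p * g p)"
  using assms by (simp add: homogeneous_on_def liouville_def dir_deriv_mult algebra_simps)

section \<open>Projectively flat metrics\<close>

locale projectively_flat =
  fixes S :: "('a::euclidean_space \<times> 'a) set" and F P :: "'a \<times> 'a \<Rightarrow> real"
  assumes open_domain: "open S"
    and smooth_F: "smooth_on S F"
    and smooth_P: "smooth_on S P"
    and homogeneous_F: "homogeneous_on S 1 F"
    and homogeneous_P: "homogeneous_on S 1 P"
    and F_nonzero: "p \<in> S \<Longrightarrow> F p \<noteq> 0"
    and base_deriv_F: "p \<in> S \<Longrightarrow> base_deriv e F p = fibre_deriv e (\<lambda>q. P q * F q) p"
begin

definition curvature_factor :: "'a \<times> 'a \<Rightarrow> real" where
  "curvature_factor p = (P p)\<^sup>2 - flat_spray P p"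

lemma smooth_PF: "smooth_on S (\<lambda>q. P q * F q)"
  by (rule smooth_on_mult[OF open_domain smooth_P smooth_F])

lemma homogeneous_PF: "homogeneous_on S 2 (\<lambda>q. P q * F q)"
  using homogeneous_on_mult[OF smooth_P smooth_F homogeneous_P homogeneous_F] by simp

lemma flat_spray_F: "p \<in> S \<Longrightarrow> flat_spray F p = 2 * P p * F p"
  using homogeneous_PF by (simp add: flat_spray_def base_deriv_F homogeneous_on_def liouville_def)

lemma flat_spray_PF:
  assumes "p \<in> S"
  shows "flat_spray (\<lambda>q. P q * F q) p = (flat_spray P p + 2 * (P p * P p)) * F p"
  using flat_spray_F[OF assms]
  by (simp add: flat_spray_def dir_deriv_mult[OF assms smooth_P smooth_F]) (simp add: algebra_simps)

lemma flat_spray_fibre_deriv_PF: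
  assumes "p \<in> S"
  shows "flat_spray (fibre_deriv e (\<lambda>q. P q * F q)) p = 2 * base_deriv e (\<lambda>q. P q * F q) p"
proof -
  let ?PF = "\<lambda>q. P q * F q" and ?v = "snd p"
  have "base_deriv ?v (fibre_deriv e ?PF) p = base_deriv ?v (base_deriv e F) p"
    by (intro dir_deriv_cong[OF open_domain assms]) (simp add: base_deriv_F)
  also have "\<dots> = base_deriv e (base_deriv ?v F) p"
    by (rule dir_deriv_commute[OF open_domain smooth_F assms])
  also have "\<dots> = base_deriv e (fibre_deriv ?v ?PF) p"
    by (intro dir_deriv_cong[OF open_domain assms]) (simp add: base_deriv_F)
  also have "\<dots> = fibre_deriv ?v (base_deriv e ?PF) p"
    by (rule dir_deriv_commute[OF open_domain smooth_PF assms])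
  also have "\<dots> = 2 * base_deriv e ?PF p"
    using homogeneous_on_base_deriv[OF open_domain smooth_PF homogeneous_PF] assms
    by (simp add: homogeneous_on_def liouville_def)
  finally show ?thesis by (simp add: flat_spray_def)
qed

lemma curvature_covector_eq:
  assumes "p \<in> S"
  shows "2 * base_deriv e P p - flat_spray (fibre_deriv e P) p - P p * fibre_deriv e P p
    = - curvature_factor p * fibre_deriv e F p / F p"
proof -
  note smooth = smooth_F smooth_P smooth_PF smooth_on_flat_spray[OF open_domain smooth_P]
    smooth_on_mult[OF open_domain] smooth_on_add[OF open_domain] smooth_on_const[OF open_domain]
  let ?PF = "\<lambda>q. P q * F q"
  have "fibre_deriv e (flat_spray ?PF) p = 3 * base_deriv e ?PF p"
    by (simp add: fibre_deriv_flat_spray[OF open_domain smooth_PF assms]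
        flat_spray_fibre_deriv_PF[OF assms])
  moreover have "fibre_deriv e (flat_spray ?PF) p
      = fibre_deriv e (\<lambda>q. (flat_spray P q + 2 * (P q * P q)) * F q) p"
    by (intro dir_deriv_cong[OF open_domain assms] flat_spray_PF)
  moreover have "\<dots> = (flat_spray P p + 2 * (P p * P p)) * fibre_deriv e F p
      + (base_deriv e P p + flat_spray (fibre_deriv e P) p + 4 * P p * fibre_deriv e P p) * F p"
    using smooth assms
    by (simp add: dir_deriv_mult dir_deriv_add fibre_deriv_flat_spray[OF open_domain])
  moreover have "base_deriv e ?PF p = P p * (P p * fibre_deriv e F p + fibre_deriv e P p * F p)
      + base_deriv e P p * F p"
    using smooth assms by (simp add: dir_deriv_mult base_deriv_F)
  ultimately have "(2 * base_deriv e P p - flat_spray (fibre_deriv e P) p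
      - P p * fibre_deriv e P p) * F p
      = - curvature_factor p * fibre_deriv e F p"
    by (simp add: curvature_factor_def algebra_simps power2_eq_square)
  then show ?thesis
    using F_nonzero[OF assms] by (simp add: field_simps)
qed

lemma rapcsak_equation:
  assumes "p \<in> S"
  shows "flat_spray (fibre_deriv e (\<lambda>q. (F q)\<^sup>2)) p - base_deriv e (\<lambda>q. (F q)\<^sup>2) p
    = 4 * P p * (F p * fibre_deriv e F p)"
proof -
  let ?E = "\<lambda>q. F q * F q"
  note smooth_E = smooth_on_mult[OF open_domain smooth_F smooth_F]
  have "base_deriv e ?E p + flat_spray (fibre_deriv e ?E) p = fibre_deriv e (flat_spray ?E) p"
    by (simp add: fibre_deriv_flat_spray[OF open_domain smooth_E assms])
  also have "\<dots> = fibre_deriv e (\<lambda>q. 4 * (P q * ?E q)) p"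
  proof (intro dir_deriv_cong[OF open_domain assms])
    show "flat_spray ?E q = 4 * (P q * ?E q)" if "q \<in> S" for q
      using flat_spray_F[OF that] that smooth_F by (simp add: flat_spray_def dir_deriv_mult)
  qed
  also have "\<dots> = 4 * (P p * fibre_deriv e ?E p + fibre_deriv e P p * ?E p)"
    using smooth_P smooth_E assms smooth_on_mult[OF open_domain] smooth_on_const[OF open_domain]
    by (simp add: dir_deriv_mult)
  finally show ?thesis
    using assms smooth_F smooth_P
    by (simp add: dir_deriv_mult base_deriv_F power2_eq_square algebra_simps)
qed

end

section \<open>Curvature of projectively flat surfaces\<close>

lemma linear_eq_sum_axis:
  fixes L :: "real^'n \<Rightarrow> real"
  assumes "linear L"
  shows "L v = (\<Sum>k\<in>UNIV. v $ k * L (axis k 1))"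
proof -
  have "L v = L (\<Sum>k\<in>UNIV. v $ k *\<^sub>R axis k 1)"
    using basis_expansion[of v] by (simp add: scalar_mult_eq_scaleR)
  then show ?thesis
    by (simp add: linear_sum[OF assms] linear_scale[OF assms])
qed

lemma linear_base_deriv:
  assumes "smooth_on S f" "p \<in> S"
  shows "linear (\<lambda>e. base_deriv e f p)"
  using linear_compose[OF _ dir_deriv_linear[OF assms], of "\<lambda>e. (e, 0)"]
  by (simp add: o_def linear_iff)

lemma linear_fibre_deriv:
  assumes "smooth_on S f" "p \<in> S"
  shows "linear (\<lambda>e. fibre_deriv e f p)"
  using linear_compose[OF _ dir_deriv_linear[OF assms], of "\<lambda>e. (0, e)"]
  by (simp add: o_def linear_iff)

lemma sum_base_deriv_axis:
  assumes "smooth_on S f" "p \<in> S"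
  shows "(\<Sum>k\<in>UNIV. snd p $ k * base_deriv (axis k 1) f p) = flat_spray f p"
  unfolding flat_spray_def by (rule linear_eq_sum_axis[OF linear_base_deriv[OF assms], symmetric])

lemma sum_fibre_deriv_axis:
  assumes "smooth_on S f" "p \<in> S"
  shows "(\<Sum>k\<in>UNIV. snd p $ k * fibre_deriv (axis k 1) f p) = liouville f p"
  unfolding liouville_def by (rule linear_eq_sum_axis[OF linear_fibre_deriv[OF assms], symmetric])

lemma pdx_eq_base_deriv:
  assumes "open S" "(x, v) \<in> S" "\<And>q. q \<in> S \<Longrightarrow> case_prod f q = g q"
  shows "pdx k f x v = base_deriv (axis k 1) g (x, v)"
proof -
  have "pdx k f x v = base_deriv (axis k 1) (case_prod f) (x, v)"
    by (simp add: pdx_def dir_deriv_def)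
  also have "\<dots> = base_deriv (axis k 1) g (x, v)"
    using assms(3) by (rule dir_deriv_cong[OF assms(1,2)])
  finally show ?thesis .
qed

lemma pdxi_eq_fibre_deriv:
  assumes "open S" "(x, v) \<in> S" "\<And>q. q \<in> S \<Longrightarrow> case_prod f q = g q"
  shows "pdxi k f x v = fibre_deriv (axis k 1) g (x, v)"
proof -
  have "pdxi k f x v = fibre_deriv (axis k 1) (case_prod f) (x, v)"
    by (simp add: pdxi_def dir_deriv_def)
  also have "\<dots> = fibre_deriv (axis k 1) g (x, v)"
    using assms(3) by (rule dir_deriv_cong[OF assms(1,2)])
  finally show ?thesis .
qed

definition radial_spray ::
  "((real^'n) \<times> (real^'n) \<Rightarrow> real) \<Rightarrow> 'n \<Rightarrow> (real^'n) \<times> (real^'n) \<Rightarrow> real" where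
  "radial_spray P i p = P p * snd p $ i"

lemma bounded_linear_fibre_coordinate: "bounded_linear (\<lambda>p. snd p $ i)"
  by (rule bounded_linear_compose[OF bounded_linear_vec_nth bounded_linear_snd])

lemma smooth_on_fibre_coordinate: "open S \<Longrightarrow> smooth_on S (\<lambda>p. snd p $ i)"
  by (rule smooth_on_bounded_linear[OF _ bounded_linear_fibre_coordinate])

lemma smooth_on_radial_spray: "open S \<Longrightarrow> smooth_on S P \<Longrightarrow> smooth_on S (radial_spray P i)"
  unfolding radial_spray_def[abs_def] by (intro smooth_on_mult smooth_on_fibre_coordinate)

lemma homogeneous_on_radial_spray:
  assumes "open S" "smooth_on S P" "homogeneous_on S 1 P"
  shows "homogeneous_on S 2 (radial_spray P i)"
  using homogeneous_on_mult[OF assms(2) smooth_on_fibre_coordinate[OF assms(1)] assms(3), of 1 i]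
  by (simp add: radial_spray_def[abs_def] homogeneous_on_def liouville_def
      dir_deriv_bounded_linear[OF bounded_linear_fibre_coordinate])

lemma dir_deriv_radial_spray:
  assumes "open S" "smooth_on S P" "p \<in> S"
  shows "dir_deriv u (radial_spray P i) p = dir_deriv u P p * snd p $ i + P p * snd u $ i"
  unfolding radial_spray_def[abs_def]
  by (simp add: dir_deriv_mult[OF assms(3,2) smooth_on_fibre_coordinate[OF assms(1)]]
      dir_deriv_bounded_linear[OF bounded_linear_fibre_coordinate])

lemma flat_spray_fibre_deriv_radial_spray:
  assumes "open S" "smooth_on S P" "p \<in> S"
  shows "flat_spray (fibre_deriv e (radial_spray P i)) p
    = flat_spray (fibre_deriv e P) p * snd p $ i + flat_spray P p * e $ i"
proof -
  have "flat_spray (fibre_deriv e (radial_spray P i)) p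
      = base_deriv (snd p) (\<lambda>q. fibre_deriv e P q * snd q $ i + P q * e $ i) p"
    unfolding flat_spray_def
    by (intro dir_deriv_cong[OF assms(1,3)]) (simp add: dir_deriv_radial_spray[OF assms(1,2)])
  also have "\<dots> = flat_spray (fibre_deriv e P) p * snd p $ i + flat_spray P p * e $ i"
    by (simp add: dir_deriv_add[OF assms(3)] dir_deriv_mult[OF assms(3)] smooth_on_mult
        smooth_on_const
        smooth_on_dir_deriv smooth_on_fibre_coordinate assms(1,2) flat_spray_def
        dir_deriv_bounded_linear[OF bounded_linear_fibre_coordinate])
  finally show ?thesis .
qed

lemma sum_radial_spray_fibre_hessian:
  assumes "open S" "smooth_on S P" "homogeneous_on S 1 P" "p \<in> S"
  shows "(\<Sum>j\<in>UNIV. radial_spray P j p * fibre_deriv (axis j 1) (fibre_deriv e (radial_spray P i)) p)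
    = P p * fibre_deriv e (radial_spray P i) p"
proof -
  note smooth = smooth_on_radial_spray[OF assms(1,2)]
  have "(\<Sum>j\<in>UNIV. radial_spray P j p * fibre_deriv (axis j 1) (fibre_deriv e (radial_spray P i)) p)
      = P p * liouville (fibre_deriv e (radial_spray P i)) p"
    unfolding sum_fibre_deriv_axis[OF smooth_on_dir_deriv[OF smooth] assms(4), symmetric]
    by (simp add: radial_spray_def sum_distrib_left mult.assoc)
  then show ?thesis
    using homogeneous_on_fibre_deriv[OF assms(1) smooth
        homogeneous_on_radial_spray[OF assms(1-3)]] assms(4)
    by (simp add: homogeneous_on_def)
qed

lemma sum_fibre_deriv_radial_spray_mult:
  assumes "open S" "smooth_on S P" "homogeneous_on S 1 P" "p \<in> S"
  shows "(\<Sum>j\<in>UNIV. fibre_deriv (axis j 1) (radial_spray P i) p * fibre_deriv e (radial_spray P j) p)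
    = 2 * fibre_deriv e P p * radial_spray P i p + P p * fibre_deriv e (radial_spray P i) p"
proof -
  let ?G = "radial_spray P i"
  note smooth = smooth_on_radial_spray[OF assms(1,2)]
  have "(\<Sum>j\<in>UNIV. fibre_deriv (axis j 1) ?G p * fibre_deriv e (radial_spray P j) p)
      = fibre_deriv e P p * (\<Sum>j\<in>UNIV. snd p $ j * fibre_deriv (axis j 1) ?G p)
        + P p * (\<Sum>j\<in>UNIV. e $ j * fibre_deriv (axis j 1) ?G p)"
    by (simp add: dir_deriv_radial_spray[OF assms(1,2,4)] sum_distrib_left sum.distrib[symmetric]
        algebra_simps)
  also have "(\<Sum>j\<in>UNIV. snd p $ j * fibre_deriv (axis j 1) ?G p) = 2 * ?G p"
    using homogeneous_on_radial_spray[OF assms(1-3)] assms(4)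
    by (simp add: sum_fibre_deriv_axis[OF smooth assms(4)] homogeneous_on_def)
  also have "(\<Sum>j\<in>UNIV. e $ j * fibre_deriv (axis j 1) ?G p) = fibre_deriv e ?G p"
    using linear_eq_sum_axis[OF linear_fibre_deriv[OF smooth assms(4)]] by metis
  finally show ?thesis by simp
qed

lemma riemann_of_radial_spray:
  assumes "open S" "smooth_on S P" "homogeneous_on S 1 P" "(x, v) \<in> S"
    and spray: "\<And>i q. q \<in> S \<Longrightarrow> case_prod (spray F i) q = radial_spray P i q"
  shows "riemann F i k x v = (if i = k then 1 else 0) * ((P (x, v))\<^sup>2 - flat_spray P (x, v))
    + (2 * base_deriv (axis k 1) P (x, v) - flat_spray (fibre_deriv (axis k 1) P) (x, v)
      - P (x, v) * fibre_deriv (axis k 1) P (x, v)) * v $ i"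
proof -
  let ?p = "(x, v)" and ?e = "\<lambda>k. axis k 1 :: real^2"
  have pdxi_spray: "case_prod (pdxi k (spray F i)) q = fibre_deriv (?e k) (radial_spray P i) q"
    if "q \<in> S" for i k q
    using that by (cases q) (simp add: pdxi_eq_fibre_deriv[OF assms(1) _ spray])
  have spray_p: "spray F i x v = radial_spray P i ?p"
    and pdxi_spray_p: "pdxi k (spray F i) x v = fibre_deriv (?e k) (radial_spray P i) ?p" for i k
    using spray[OF assms(4)] pdxi_spray[OF assms(4)] by simp_all
  have "pdx k (spray F i) x v = base_deriv (?e k) P ?p * v $ i"
    by (simp add: pdx_eq_base_deriv[OF assms(1,4) spray] dir_deriv_radial_spray[OF assms(1,2,4)])
  moreover have "(\<Sum>j\<in>UNIV. v $ j * pdx j (pdxi k (spray F i)) x v)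
      = flat_spray (fibre_deriv (?e k) P) ?p * v $ i + (if i = k then 1 else 0) * flat_spray P ?p"
    using sum_base_deriv_axis[OF smooth_on_dir_deriv[OF smooth_on_radial_spray[OF assms(1,2)]]
        assms(4)]
    by (simp add: pdx_eq_base_deriv[OF assms(1,4) pdxi_spray]
        flat_spray_fibre_deriv_radial_spray[OF assms(1,2,4)] axis_def)
  moreover have "(\<Sum>j\<in>UNIV. spray F j x v * pdxi j (pdxi k (spray F i)) x v)
      = P ?p * fibre_deriv (?e k) (radial_spray P i) ?p"
    using sum_radial_spray_fibre_hessian[OF assms(1-4)]
    by (simp add: pdxi_eq_fibre_deriv[OF assms(1,4) pdxi_spray] spray_p)
  moreover have "(\<Sum>j\<in>UNIV. pdxi j (spray F i) x v * pdxi k (spray F j) x v)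
      = 2 * fibre_deriv (?e k) P ?p * radial_spray P i ?p
        + P ?p * fibre_deriv (?e k) (radial_spray P i) ?p"
    unfolding pdxi_spray_p by (rule sum_fibre_deriv_radial_spray_mult[OF assms(1-4)])
  ultimately show ?thesis
    unfolding riemann_def
    by (simp add: dir_deriv_radial_spray[OF assms(1,2,4)] radial_spray_def axis_def algebra_simps
        power2_eq_square)
qed

lemma case_prod_sqF: "case_prod (sqF (curry F)) q = (F q)\<^sup>2"
  by (simp add: sqF_def split_beta)

lemma fund_g_eq:
  assumes "open S" "smooth_on S F" "(x, v) \<in> S"
  shows "fund_g (curry F) i j x v
    = fibre_deriv (axis i 1) F (x, v) * fibre_deriv (axis j 1) F (x, v)
    + F (x, v) * fibre_deriv (axis i 1) (fibre_deriv (axis j 1) F) (x, v)"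
proof -
  let ?e = "\<lambda>k. axis k 1 :: real^2"
  have "case_prod (pdxi j (sqF (curry F))) q = 2 * (F q * fibre_deriv (?e j) F q)" if "q \<in> S" for q
    using that
    by (cases q) (simp add: pdxi_eq_fibre_deriv[OF assms(1) _ case_prod_sqF] power2_eq_square
          dir_deriv_mult[OF _ assms(2,2)])
  then show ?thesis
    unfolding fund_g_def
    by (simp add: pdxi_eq_fibre_deriv[OF assms(1,3)]
        dir_deriv_mult[OF assms(3) smooth_on_const[OF assms(1)]
            smooth_on_mult[OF assms(1,2) smooth_on_dir_deriv[OF assms(2)]]]
        dir_deriv_mult[OF assms(3,2) smooth_on_dir_deriv[OF assms(2)]])
qed

locale projectively_flat_surface = projectively_flat S F P
  for S :: "((real^2) \<times> (real^2)) set" and F P +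
  assumes det_fund_g_nonzero: "(x, v) \<in> S \<Longrightarrow> det (\<chi> i j. fund_g (curry F) i j x v) \<noteq> 0"
begin

lemma smooth_energy: "smooth_on S (\<lambda>p. (F p)\<^sup>2)"
  by (rule smooth_on_power[OF open_domain smooth_F])

lemma case_prod_pdx_sqF:
  "q \<in> S \<Longrightarrow> case_prod (pdx k (sqF (curry F))) q = base_deriv (axis k 1) (\<lambda>p. (F p)\<^sup>2) q"
  by (cases q) (simp add: pdx_eq_base_deriv[OF open_domain _ case_prod_sqF])

lemma fund_g_mult_fibre:
  assumes "(x, v) \<in> S"
  shows "(\<Sum>j\<in>UNIV. fund_g (curry F) i j x v * v $ j) = F (x, v) * fibre_deriv (axis i 1) F (x, v)"
proof -
  let ?p = "(x, v)" and ?e = "\<lambda>k. axis k 1 :: real^2"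
  have "(\<Sum>j\<in>UNIV. fund_g (curry F) i j x v * v $ j)
      = fibre_deriv (?e i) F ?p * (\<Sum>j\<in>UNIV. v $ j * fibre_deriv (?e j) F ?p)
        + F ?p * (\<Sum>j\<in>UNIV. v $ j * fibre_deriv (?e j) (fibre_deriv (?e i) F) ?p)"
    unfolding fund_g_eq[OF open_domain smooth_F assms]
        dir_deriv_commute[OF open_domain smooth_F assms, of "(0, ?e i)"]
    by (simp add: sum_distrib_left sum.distrib[symmetric] algebra_simps)
  also have "(\<Sum>j\<in>UNIV. v $ j * fibre_deriv (?e j) F ?p) = F ?p"
    using sum_fibre_deriv_axis[OF smooth_F assms] homogeneous_F assms
    by (simp add: homogeneous_on_def)
  also have "(\<Sum>j\<in>UNIV. v $ j * fibre_deriv (?e j) (fibre_deriv (?e i) F) ?p) = 0"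
    using sum_fibre_deriv_axis[OF smooth_on_dir_deriv[OF smooth_F] assms]
      homogeneous_on_fibre_deriv[OF open_domain smooth_F homogeneous_F] assms
    by (simp add: homogeneous_on_def)
  finally show ?thesis
    by (simp only: mult_zero_right add_0_right mult.commute)
qed

lemma spray_projectively_flat:
  assumes "(x, v) \<in> S"
  shows "spray (curry F) i x v = P (x, v) * v $ i"
proof -
  let ?E = "\<lambda>p. (F p)\<^sup>2" and ?e = "\<lambda>k. axis k 1 :: real^2"
  define g :: "real^2^2" where "g = (\<chi> i j. fund_g (curry F) i j x v)"
  have "invertible g"
    using det_fund_g_nonzero[OF assms] by (simp add: invertible_det_nz g_def)
  then have matrix_inv: "matrix_inv g ** g = mat 1"
    unfolding matrix_inv_def invertible_def by (rule someI2_ex) simp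
  define w where "w = (\<chi> l. (\<Sum>k\<in>UNIV. pdxi l (pdx k (sqF (curry F))) x v * v $ k)
      - pdx l (sqF (curry F)) x v)"
  have "w $ l = (4 * P (x, v)) * (g *v v) $ l" for l
  proof -
    have "pdxi l (pdx k (sqF (curry F))) x v = base_deriv (?e k) (fibre_deriv (?e l) ?E) (x, v)"
      for k
      unfolding dir_deriv_commute[OF open_domain smooth_energy assms, of "(?e k, 0)"]
      by (rule pdxi_eq_fibre_deriv[OF open_domain assms case_prod_pdx_sqF])
    then have "w $ l = flat_spray (fibre_deriv (?e l) ?E) (x, v) - base_deriv (?e l) ?E (x, v)"
      by (simp add: w_def sum_base_deriv_axis[OF smooth_on_dir_deriv[OF smooth_energy] assms,
          symmetric]
          pdx_eq_base_deriv[OF open_domain assms case_prod_sqF] mult.commute)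
    then show ?thesis
      by (simp add: rapcsak_equation[OF assms] matrix_vector_mult_def g_def
          fund_g_mult_fibre[OF assms])
  qed
  then have "w = (4 * P (x, v)) *\<^sub>R (g *v v)"
    by (simp add: vec_eq_iff)
  then have "matrix_inv g *v w = (4 * P (x, v)) *\<^sub>R v"
    by (simp add: matrix_vector_mult_scaleR matrix_vector_mul_assoc matrix_inv)
  moreover have "spray (curry F) i x v = 1/4 * (matrix_inv g *v w) $ i"
    by (simp add: spray_def ginv_def g_def[symmetric] matrix_vector_mult_def w_def)
  ultimately show ?thesis
    by simp
qed

theorem riemann_projectively_flat:
  assumes "(x, v) \<in> S"
  shows "riemann (curry F) i k x v = curvature_factor (x, v)
    * ((if i = k then 1 else 0) - pdxi k (curry F) x v / F (x, v) * v $ i)"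
proof -
  have spray: "case_prod (spray (curry F) i) q = radial_spray P i q" if "q \<in> S" for i q
    using that by (cases q) (simp add: spray_projectively_flat radial_spray_def)
  have "pdxi k (curry F) x v = fibre_deriv (axis k 1) F (x, v)"
    by (simp add: pdxi_eq_fibre_deriv[OF open_domain assms, where g = F])
  then show ?thesis
    by (subst riemann_of_radial_spray[OF open_domain smooth_P homogeneous_P assms spray])
      (simp_all only: curvature_covector_eq[OF assms] curvature_factor_def,
        simp add: algebra_simps diff_divide_distrib)
qed

theorem ricci_projectively_flat:
  assumes "(x, v) \<in> S"
  shows "ricci (curry F) x v = curvature_factor (x, v)"
proof -
  have "(\<Sum>k\<in>UNIV. v $ k * pdxi k (curry F) x v) = F (x, v)"
    using sum_fibre_deriv_axis[OF smooth_F assms] homogeneous_F assms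
    by (simp add: pdxi_eq_fibre_deriv[OF open_domain assms, where g = F] homogeneous_on_def)
  moreover have "ricci (curry F) x v
      = curvature_factor (x, v) * (2 - (\<Sum>k\<in>UNIV. v $ k * pdxi k (curry F) x v) / F (x, v))"
    unfolding ricci_def riemann_projectively_flat[OF assms] sum_2
    by (simp add: algebra_simps add_divide_distrib)
  ultimately show ?thesis
    using F_nonzero[OF assms] by simp
qed

end

section \<open>The Funk metric\<close>

lemma det_randers:
  fixes a :: "real^2^2" and v b l :: "real^2"
  assumes "a $ 1 $ 2 = a $ 2 $ 1" "\<alpha> \<noteq> 0" "\<alpha> *\<^sub>R l = a *v v" "\<alpha> = l \<bullet> v"
  shows "det (\<chi> i j. (l + b) $ i * (l + b) $ j + ((l + b) \<bullet> v) / \<alpha> * (a $ i $ j - l $ i * l $ j))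
    = (((l + b) \<bullet> v) / \<alpha>) ^ 3 * det a"
    (is "det ?g = _")
proof -
  define \<kappa> where "\<kappa> = ((l + b) \<bullet> v) / \<alpha>"
  have gradient: "\<alpha> * l$1 = a$1$1 * v$1 + a$1$2 * v$2" "\<alpha> * l$2 = a$2$1 * v$1 + a$2$2 * v$2"
    using assms(3) by (simp_all add: vec_eq_iff forall_2 matrix_vector_mult_def sum_2)
  have euler: "\<alpha> = l$1 * v$1 + l$2 * v$2" using assms(4) by (simp add: inner_vec_def sum_2)
  have euler_shifted: "\<kappa> * \<alpha> = (l$1 + b$1) * v$1 + (l$2 + b$2) * v$2"
    using assms(2) by (simp add: \<kappa>_def inner_vec_def sum_2)
  have "\<alpha>\<^sup>2 * det ?g = \<alpha>\<^sup>2 * \<kappa> ^ 3 * det a"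
    unfolding det_2 vec_lambda_beta \<kappa>_def[symmetric] vector_add_component
    using gradient euler euler_shifted assms(1) by algebra
  then show ?thesis using assms(2) by (simp add: \<kappa>_def)
qed

definition slit_disc :: "((real^2) \<times> (real^2)) set" where
  "slit_disc = ball 0 rK \<times> (- {0})"

definition gap :: "real \<Rightarrow> 'a::real_inner \<Rightarrow> real" where
  "gap r x = r\<^sup>2 - (norm x)\<^sup>2"

definition klein_metric :: "real^2 \<Rightarrow> real^2 \<Rightarrow> real^2 \<Rightarrow> real" where
  "klein_metric x u w = (gap rK x * (u \<bullet> w) + (x \<bullet> u) * (x \<bullet> w)) / (gap rK x)\<^sup>2"

definition klein_factor :: "real^2 \<Rightarrow> real^2 \<Rightarrow> real" where
  "klein_factor x v = (x \<bullet> v) / gap rK x"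

definition phiF :: "real^2 \<Rightarrow> real^2 \<Rightarrow> real" where
  "phiF x v = (1 - rK\<^sup>2) * (gap 1 x * (norm v)\<^sup>2 + 2 * (x \<bullet> v)\<^sup>2) / (gap rK x * (gap 1 x)\<^sup>2)"

definition psiF :: "real^2 \<Rightarrow> real^2 \<Rightarrow> real" where
  "psiF x v = 2 * (1 - rK\<^sup>2) * (x \<bullet> v) / ((gap 1 x)^3 * (gap rK x)\<^sup>2)
    * (gap 1 x * (norm v)\<^sup>2 * (3 * gap rK x - gap 1 x) + 2 * (x \<bullet> v)\<^sup>2 * (2 * gap rK x - gap 1 x))"

definition tauF :: "2 \<Rightarrow> real^2 \<Rightarrow> real^2 \<Rightarrow> real" where
  "tauF k x v = (1 - rK\<^sup>2) * (x $ k * (norm v)\<^sup>2 - v $ k * (x \<bullet> v))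
    / (FF x v * (gap rK x)\<^sup>2 * gap 1 x)"

definition funk_factor :: "real^2 \<Rightarrow> real^2 \<Rightarrow> real" where
  "funk_factor x v = klein_factor x v + phiF x v / (2 * FF x v)"

lemma open_slit_disc: "open slit_disc"
  unfolding slit_disc_def by (intro open_Times) auto

lemma rK_bounds: "0 < rK" "rK < 1"
  by (auto simp: rK_def field_simps add_pos_pos)

lemma gap_rK_less_gap_1: "gap rK x < gap 1 x"
  using rK_bounds by (simp add: gap_def abs_square_less_1)

lemma gap_rK_pos: "(x, v) \<in> slit_disc \<Longrightarrow> gap rK x > 0"
  by (simp add: slit_disc_def gap_def power_strict_mono)

lemma gap_1_pos: "(x, v) \<in> slit_disc \<Longrightarrow> gap 1 x > 0"
  using gap_rK_pos gap_rK_less_gap_1 by (meson order.strict_trans)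

lemma slit_disc_nonzero: "(x, v) \<in> slit_disc \<Longrightarrow> v \<noteq> 0"
  by (simp add: slit_disc_def)

lemma klein_metric_pos:
  assumes "(x, v) \<in> slit_disc"
  shows "klein_metric x v v > 0"
  using gap_rK_pos[OF assms] slit_disc_nonzero[OF assms]
  by (auto simp: klein_metric_def intro!: divide_pos_pos add_pos_nonneg)

lemma alphaF_eq_sqrt:
  assumes "(x, v) \<in> slit_disc"
  shows "alphaF x v = sqrt (klein_metric x v v)"
  using gap_rK_pos[OF assms]
  by (simp add: alphaF_def klein_metric_def gap_def real_sqrt_divide power2_norm_eq_inner
      power2_eq_square[of "x \<bullet> v"])

lemma alphaF_sq: "(x, v) \<in> slit_disc \<Longrightarrow> (alphaF x v)\<^sup>2 = klein_metric x v v"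
  using klein_metric_pos by (simp add: alphaF_eq_sqrt less_imp_le)

lemma alphaF_pos: "(x, v) \<in> slit_disc \<Longrightarrow> alphaF x v > 0"
  using klein_metric_pos by (simp add: alphaF_eq_sqrt)

lemma betaF_eq: "betaF x v = (1 - rK\<^sup>2) * (x \<bullet> v) / (gap rK x * gap 1 x)"
  by (simp add: betaF_def gap_def)

lemma FF_pos:
  assumes "(x, v) \<in> slit_disc"
  shows "FF x v > 0"
proof -
  note pos = gap_rK_pos[OF assms] gap_1_pos[OF assms]
  have "0 < 1 - rK\<^sup>2" "1 - rK\<^sup>2 < gap 1 x"
    using rK_bounds pos by (auto simp: gap_def abs_square_less_1)
  then have "\<bar>betaF x v\<bar> = (1 - rK\<^sup>2) / gap 1 x * (\<bar>x \<bullet> v\<bar> / gap rK x)" "(1 - rK\<^sup>2) / gap 1 x \<le> 1"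
    using pos by (simp_all add: betaF_eq abs_mult)
  then have "\<bar>betaF x v\<bar> \<le> \<bar>x \<bullet> v\<bar> / gap rK x"
    using pos mult_right_mono[of "(1 - rK\<^sup>2) / gap 1 x" 1 "\<bar>x \<bullet> v\<bar> / gap rK x"] by simp
  also have "\<dots> < alphaF x v"
  proof (rule power_less_imp_less_base)
    show "(\<bar>x \<bullet> v\<bar> / gap rK x)\<^sup>2 < (alphaF x v)\<^sup>2"
      using pos slit_disc_nonzero[OF assms]
      by (simp add: alphaF_sq[OF assms] klein_metric_def power_divide divide_strict_right_mono
          flip: power2_eq_square)
  qed (simp add: alphaF_pos[OF assms] less_imp_le)
  finally show ?thesis
    by (simp add: FF_def abs_less_iff)
qed

lemma FF_nonzero: "p \<in> slit_disc \<Longrightarrow> case_prod FF p \<noteq> 0"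
  using FF_pos by (cases p) (metis case_prod_conv less_irrefl)

lemma smooth_on_inner_base_fibre: "open S \<Longrightarrow> smooth_on S (\<lambda>p. fst p \<bullet> snd p)"
  for S :: "('a::euclidean_space \<times> 'a) set"
  by (intro smooth_on_inner bounded_linear_fst bounded_linear_snd)

lemma smooth_on_norm_sq_fibre: "open S \<Longrightarrow> smooth_on S (\<lambda>p. (norm (snd p))\<^sup>2)"
  for S :: "('a::euclidean_space \<times> 'a) set"
  unfolding power2_norm_eq_inner by (intro smooth_on_inner bounded_linear_snd)

lemma smooth_on_gap: "open S \<Longrightarrow> smooth_on S (\<lambda>p. gap r (fst p))"
  for S :: "('a::euclidean_space \<times> 'a) set"
  unfolding gap_def power2_norm_eq_inner
  by (intro smooth_on_diff smooth_on_const smooth_on_inner bounded_linear_fst)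

lemmas smooth_on_slit_disc_intros = smooth_on_const smooth_on_add smooth_on_mult smooth_on_divide
    smooth_on_power
  smooth_on_inner_base_fibre smooth_on_norm_sq_fibre smooth_on_gap open_slit_disc

lemma smooth_klein_factor: "smooth_on slit_disc (case_prod klein_factor)"
  unfolding klein_factor_def case_prod_unfold
  by (intro smooth_on_slit_disc_intros) (auto dest: gap_rK_pos)

lemma smooth_phiF: "smooth_on slit_disc (case_prod phiF)"
  unfolding phiF_def case_prod_unfold
  by (intro smooth_on_slit_disc_intros) (auto dest: gap_rK_pos gap_1_pos)

lemma smooth_betaF: "smooth_on slit_disc (case_prod betaF)"
  unfolding betaF_eq case_prod_unfold
  by (intro smooth_on_slit_disc_intros) (auto dest: gap_rK_pos gap_1_pos)

lemma smooth_alphaF: "smooth_on slit_disc (case_prod alphaF)"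
proof (rule smooth_on_cong[OF open_slit_disc])
  show "smooth_on slit_disc (\<lambda>p. sqrt ((gap rK (fst p) * (norm (snd p))\<^sup>2
      + (fst p \<bullet> snd p) * (fst p \<bullet> snd p)) / (gap rK (fst p))\<^sup>2))"
    by (intro smooth_on_sqrt smooth_on_slit_disc_intros)
      (use gap_rK_pos klein_metric_pos in \<open>force simp: klein_metric_def power2_norm_eq_inner\<close>)+
qed (auto simp: alphaF_eq_sqrt klein_metric_def power2_norm_eq_inner)

lemma smooth_FF: "smooth_on slit_disc (case_prod FF)"
  using smooth_on_add[OF open_slit_disc smooth_alphaF smooth_betaF]
  by (simp add: FF_def case_prod_unfold)

lemma smooth_funk_factor: "smooth_on slit_disc (case_prod funk_factor)"
proof -
  have "smooth_on slit_disc (\<lambda>p. case_prod klein_factor p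
      + case_prod phiF p / (2 * case_prod FF p))"
    using FF_nonzero
    by (intro smooth_on_slit_disc_intros smooth_klein_factor smooth_phiF smooth_FF) auto
  then show ?thesis by (simp add: funk_factor_def case_prod_unfold)
qed

lemma FF_scaleR:
  assumes "c > 0"
  shows "FF x (c *\<^sub>R v) = c * FF x v"
proof -
  have "(rK\<^sup>2 - (norm x)\<^sup>2) * (norm (c *\<^sub>R v))\<^sup>2 + (x \<bullet> c *\<^sub>R v)\<^sup>2
      = c\<^sup>2 * ((rK\<^sup>2 - (norm x)\<^sup>2) * (norm v)\<^sup>2 + (x \<bullet> v)\<^sup>2)"
    by (simp add: power_mult_distrib algebra_simps)
  then have "alphaF x (c *\<^sub>R v) = c * alphaF x v"
    using assms by (simp only: alphaF_def real_sqrt_mult) simp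
  then show ?thesis
    by (simp add: FF_def betaF_def algebra_simps)
qed

lemma phiF_scaleR: "phiF x (c *\<^sub>R v) = c\<^sup>2 * phiF x v"
  by (simp add: phiF_def power_mult_distrib algebra_simps)

lemma funk_factor_scaleR: "c > 0 \<Longrightarrow> funk_factor x (c *\<^sub>R v) = c * funk_factor x v"
  by (simp add: funk_factor_def klein_factor_def phiF_scaleR FF_scaleR power2_eq_square
      distrib_left)

lemma homogeneous_FF: "homogeneous_on slit_disc 1 (case_prod FF)"
  using homogeneous_onI[of slit_disc "case_prod FF" 1] by (simp add: FF_scaleR)

lemma homogeneous_funk_factor: "homogeneous_on slit_disc 1 (case_prod funk_factor)"
  using homogeneous_onI[of slit_disc "case_prod funk_factor" 1] by (simp add: funk_factor_scaleR)

lemma DERIV_inner_line: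
  "((\<lambda>t. (x + t *\<^sub>R a) \<bullet> (v + t *\<^sub>R b)) has_real_derivative a \<bullet> v + x \<bullet> b) (at 0)"
  by (auto simp: inner_add_left inner_add_right intro!: derivative_eq_intros)

lemma DERIV_gap_line:
  "((\<lambda>t. gap r (x + t *\<^sub>R a)) has_real_derivative - 2 * (x \<bullet> a)) (at 0)"
  unfolding gap_def power2_norm_eq_inner
  by (rule derivative_eq_intros DERIV_inner_line refl)+ (simp add: inner_commute)

lemma dir_deriv_case_prodI:
  assumes "((\<lambda>t. f (x + t *\<^sub>R a) (v + t *\<^sub>R b)) has_real_derivative f') (at 0)"
  shows "dir_deriv (a, b) (case_prod f) (x, v) = f'"
  using assms by (simp add: dir_deriv_def DERIV_imp_deriv)

lemma dir_deriv_klein_factor: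
  assumes "(x, v) \<in> slit_disc"
  shows "dir_deriv (a, b) (case_prod klein_factor) (x, v)
    = (a \<bullet> v + x \<bullet> b) / gap rK x + 2 * (x \<bullet> v) * (x \<bullet> a) / (gap rK x)\<^sup>2"
  unfolding klein_factor_def using gap_rK_pos[OF assms]
  by (intro dir_deriv_case_prodI)
    (auto intro!: derivative_eq_intros DERIV_inner_line DERIV_gap_line simp: field_simps
        power2_eq_square)

lemma dir_deriv_betaF:
  assumes "(x, v) \<in> slit_disc"
  shows "dir_deriv (a, b) (case_prod betaF) (x, v)
      = (1 - rK\<^sup>2) * (a \<bullet> v + x \<bullet> b) / (gap rK x * gap 1 x)
    + betaF x v * (2 * (x \<bullet> a) / gap rK x + 2 * (x \<bullet> a) / gap 1 x)"
  using gap_rK_pos[OF assms] gap_1_pos[OF assms]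
  by (intro dir_deriv_case_prodI, unfold betaF_eq)
    (auto intro!: derivative_eq_intros DERIV_inner_line DERIV_gap_line simp: divide_simps,
      simp add: algebra_simps)

lemma dir_deriv_phiF:
  assumes "(x, v) \<in> slit_disc"
  shows "dir_deriv (a, b) (case_prod phiF) (x, v)
    = (1 - rK\<^sup>2) * (2 * gap 1 x * (v \<bullet> b) - 2 * (x \<bullet> a) * (norm v)\<^sup>2 + 4 * (x \<bullet> v) * (a \<bullet> v + x \<bullet> b))
        / (gap rK x * (gap 1 x)\<^sup>2)
      + phiF x v * (2 * (x \<bullet> a) / gap rK x + 4 * (x \<bullet> a) / gap 1 x)"
  using gap_rK_pos[OF assms] gap_1_pos[OF assms]
  by (intro dir_deriv_case_prodI, unfold phiF_def power2_norm_eq_inner)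
    (auto intro!: derivative_eq_intros DERIV_inner_line DERIV_gap_line simp: divide_simps
        inner_commute,
      simp_all add: algebra_simps power2_eq_square)

text \<open>\<open>\<phi>\<close> is the covariant derivative of the closed form \<open>\<beta>\<close> along the geodesics of \<open>\<alpha>\<close>.\<close>

lemma base_deriv_betaF:
  assumes "(x, v) \<in> slit_disc"
  shows "base_deriv e (case_prod betaF) (x, v)
    = fibre_deriv e (\<lambda>p. case_prod klein_factor p * case_prod betaF p) (x, v)
      + fibre_deriv e (case_prod phiF) (x, v) / 2"
  using gap_rK_pos[OF assms] gap_1_pos[OF assms]
  by (simp add: dir_deriv_mult[OF assms smooth_klein_factor smooth_betaF]
      dir_deriv_klein_factor[OF assms]
      dir_deriv_betaF[OF assms] dir_deriv_phiF[OF assms] klein_factor_def betaF_eq divide_simps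
          inner_commute)
    (simp add: algebra_simps power2_eq_square)

lemma dir_deriv_klein_metric:
  assumes "(x, v) \<in> slit_disc"
  shows "dir_deriv (a, b) (\<lambda>(x, v). klein_metric x v v) (x, v)
    = 2 * (klein_metric x v b + (x \<bullet> a) / gap rK x * klein_metric x v v
      + klein_factor x v * klein_metric x v a)"
  using gap_rK_pos[OF assms]
  by (intro dir_deriv_case_prodI, unfold klein_metric_def klein_factor_def)
    (auto intro!: derivative_eq_intros DERIV_inner_line DERIV_gap_line simp: divide_simps
        inner_commute,
      simp_all add: algebra_simps eval_nat_numeral)

lemma alphaF_mult_dir_deriv:
  assumes "(x, v) \<in> slit_disc"
  shows "alphaF x v * dir_deriv (a, b) (case_prod alphaF) (x, v)
    = klein_metric x v b + (x \<bullet> a) / gap rK x * klein_metric x v v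
      + klein_factor x v * klein_metric x v a"
proof -
  have "dir_deriv (a, b) (\<lambda>p. case_prod alphaF p * case_prod alphaF p) (x, v)
      = dir_deriv (a, b) (\<lambda>(x, v). klein_metric x v v) (x, v)"
    by (intro dir_deriv_cong[OF open_slit_disc assms])
      (auto simp: alphaF_sq simp flip: power2_eq_square)
  then show ?thesis
    by (simp add: dir_deriv_mult[OF assms smooth_alphaF smooth_alphaF]
        dir_deriv_klein_metric[OF assms])
qed

lemma base_deriv_alphaF:
  assumes "(x, v) \<in> slit_disc"
  shows "base_deriv e (case_prod alphaF) (x, v)
    = fibre_deriv e (\<lambda>p. case_prod klein_factor p * case_prod alphaF p) (x, v)"
proof -
  have "alphaF x v * base_deriv e (case_prod alphaF) (x, v)
      = alphaF x v * fibre_deriv e (\<lambda>p. case_prod klein_factor p * case_prod alphaF p) (x, v)"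
    using alphaF_mult_dir_deriv[OF assms, of 0 e] alphaF_mult_dir_deriv[OF assms, of e 0]
    by (simp add: dir_deriv_mult[OF assms smooth_klein_factor smooth_alphaF]
        dir_deriv_klein_factor[OF assms]
        klein_metric_def[of _ _ 0] distrib_left mult.left_commute alphaF_sq[OF assms, symmetric]
            power2_eq_square)
  then show ?thesis
    using alphaF_pos[OF assms] by simp
qed

lemma funk_factor_mult_FF:
  assumes "(x, v) \<in> slit_disc"
  shows "funk_factor x v * FF x v = klein_factor x v * FF x v + 1/2 * phiF x v"
  using FF_pos[OF assms] by (simp add: funk_factor_def distrib_right)

lemma base_deriv_FF:
  assumes "(x, v) \<in> slit_disc"
  shows "base_deriv e (case_prod FF) (x, v)
      = fibre_deriv e (\<lambda>p. case_prod funk_factor p * case_prod FF p) (x, v)"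
proof -
  note smooth = smooth_alphaF smooth_betaF smooth_phiF smooth_on_const[OF open_slit_disc]
    smooth_on_add[OF open_slit_disc] smooth_on_mult[OF open_slit_disc smooth_klein_factor]
    smooth_on_mult[OF open_slit_disc smooth_on_const[OF open_slit_disc]]
  have "base_deriv e (case_prod FF) (x, v)
      = base_deriv e (\<lambda>p. case_prod alphaF p + case_prod betaF p) (x, v)"
    by (simp add: FF_def case_prod_unfold)
  also have "\<dots> = fibre_deriv e (\<lambda>p. case_prod klein_factor p * case_prod alphaF p
      + case_prod klein_factor p * case_prod betaF p + 1/2 * case_prod phiF p) (x, v)"
    by (simp only: dir_deriv_add[OF assms]
        dir_deriv_mult[OF assms smooth_on_const[OF open_slit_disc] smooth_phiF]
        dir_deriv_const smooth base_deriv_alphaF[OF assms] base_deriv_betaF[OF assms])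
  also have "\<dots> = fibre_deriv e (\<lambda>p. case_prod funk_factor p * case_prod FF p) (x, v)"
    by (intro dir_deriv_cong[OF open_slit_disc assms])
      (clarsimp simp: funk_factor_mult_FF, simp add: FF_def distrib_left)
  finally show ?thesis .
qed

definition klein_matrix :: "real^2 \<Rightarrow> real^2^2" where
  "klein_matrix x = (\<chi> i j. klein_metric x (axis i 1) (axis j 1))"

lemma klein_metric_commute: "klein_metric x u w = klein_metric x w u"
  by (simp add: klein_metric_def inner_commute mult.commute)

lemma linear_klein_metric: "linear (klein_metric x u)"
  by (rule linearI) (simp_all add: klein_metric_def inner_simps algebra_simps add_divide_distrib)

lemma klein_matrix_mult: "(klein_matrix x *v v) $ i = klein_metric x (axis i 1) v"
proof -
  have "klein_metric x (axis i 1) v = (\<Sum>j\<in>UNIV. v $ j * klein_metric x (axis i 1) (axis j 1))"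
    by (rule linear_eq_sum_axis[OF linear_klein_metric])
  then show ?thesis
    by (simp add: klein_matrix_def matrix_vector_mult_def mult.commute)
qed

lemma det_klein_matrix:
  assumes "gap rK x \<noteq> 0"
  shows "det (klein_matrix x) = rK\<^sup>2 / (gap rK x) ^ 3"
proof -
  have "rK\<^sup>2 = gap rK x + (x $ 1)\<^sup>2 + (x $ 2)\<^sup>2"
    by (simp add: gap_def norm_vec_def L2_set_def sum_2)
  then show ?thesis
    using assms
    by (simp add: klein_matrix_def det_2 klein_metric_def inner_axis[of x] inner_axis_axis
        divide_simps)
      (simp add: algebra_simps eval_nat_numeral)
qed

lemma linear_betaF: "linear (betaF x)"
  by (rule linearI) (simp_all add: betaF_eq inner_add_right distrib_left add_divide_distrib)

lemma fibre_deriv_alphaF: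
  assumes "(x, v) \<in> slit_disc"
  shows "alphaF x v * fibre_deriv e (case_prod alphaF) (x, v) = klein_metric x v e"
  using alphaF_mult_dir_deriv[OF assms, of 0 e] by (simp add: klein_metric_def)

lemma fibre_hessian_alphaF:
  assumes "(x, v) \<in> slit_disc"
  shows "alphaF x v * fibre_deriv a (fibre_deriv b (case_prod alphaF)) (x, v)
    = klein_metric x a b
      - fibre_deriv a (case_prod alphaF) (x, v) * fibre_deriv b (case_prod alphaF) (x, v)"
proof -
  have "klein_metric x (v + t *\<^sub>R a) b = klein_metric x v b + t * klein_metric x a b" for t
    by (simp add: klein_metric_def inner_simps algebra_simps add_divide_distrib)
  then have "fibre_deriv a (\<lambda>(x, v). klein_metric x v b) (x, v) = klein_metric x a b"
    by (intro dir_deriv_case_prodI) (auto intro!: derivative_eq_intros)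
  moreover have "fibre_deriv a (\<lambda>p. case_prod alphaF p * fibre_deriv b (case_prod alphaF) p) (x, v)
      = fibre_deriv a (\<lambda>(x, v). klein_metric x v b) (x, v)"
    by (intro dir_deriv_cong[OF open_slit_disc assms]) (auto simp: fibre_deriv_alphaF)
  ultimately show ?thesis
    by (simp add: dir_deriv_mult[OF assms smooth_alphaF smooth_on_dir_deriv[OF smooth_alphaF]])
qed

lemma fibre_deriv_FF:
  assumes "(x, v) \<in> slit_disc"
  shows "fibre_deriv e (case_prod FF) (x, v) = fibre_deriv e (case_prod alphaF) (x, v) + betaF x e"
proof -
  have "case_prod FF = (\<lambda>p. case_prod alphaF p + case_prod betaF p)"
    by (auto simp: FF_def)
  then show ?thesis
    by (simp add: dir_deriv_add[OF assms smooth_alphaF smooth_betaF] dir_deriv_betaF[OF assms]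
        betaF_eq)
qed

lemma fibre_hessian_FF:
  assumes "(x, v) \<in> slit_disc"
  shows "fibre_deriv a (fibre_deriv b (case_prod FF)) (x, v)
      = fibre_deriv a (fibre_deriv b (case_prod alphaF)) (x, v)"
proof -
  have "smooth_on slit_disc (\<lambda>p. fibre_deriv b (case_prod FF) p
      - fibre_deriv b (case_prod alphaF) p)"
    by (intro smooth_on_diff open_slit_disc smooth_on_dir_deriv smooth_FF smooth_alphaF)
  then have smooth: "smooth_on slit_disc (\<lambda>(x, v). betaF x b)"
    by (rule smooth_on_cong[OF open_slit_disc]) (auto simp: fibre_deriv_FF)
  have "fibre_deriv a (fibre_deriv b (case_prod FF)) (x, v)
      = fibre_deriv a (\<lambda>p. fibre_deriv b (case_prod alphaF) p + (\<lambda>(x, v). betaF x b) p) (x, v)"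
    by (intro dir_deriv_cong[OF open_slit_disc assms]) (auto simp: fibre_deriv_FF)
  moreover have "fibre_deriv a (\<lambda>(x, v). betaF x b) (x, v) = 0"
    by (intro dir_deriv_case_prodI) simp
  ultimately show ?thesis
    by (simp only: dir_deriv_add[OF assms smooth_on_dir_deriv[OF smooth_alphaF] smooth] add_0_right)
qed

lemma liouville_alphaF:
  assumes "(x, v) \<in> slit_disc"
  shows "liouville (case_prod alphaF) (x, v) = alphaF x v"
proof -
  have "alphaF x v * liouville (case_prod alphaF) (x, v) = alphaF x v * alphaF x v"
    using alphaF_sq[OF assms]
    by (simp add: liouville_def fibre_deriv_alphaF[OF assms] power2_eq_square)
  then show ?thesis
    using alphaF_pos[OF assms] by simp
qed

lemma det_fund_g_FF:
  assumes "(x, v) \<in> slit_disc"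
  shows "det (\<chi> i j. fund_g FF i j x v) = (FF x v / alphaF x v) ^ 3 * det (klein_matrix x)"
proof -
  let ?e = "\<lambda>i. axis i 1 :: real^2" and ?\<alpha> = "alphaF x v"
  define l :: "real^2" where "l = (\<chi> i. fibre_deriv (?e i) (case_prod alphaF) (x, v))"
  define b :: "real^2" where "b = (\<chi> i. betaF x (?e i))"
  have \<alpha>: "?\<alpha> \<noteq> 0" using alphaF_pos[OF assms] by simp
  have gradient: "?\<alpha> *\<^sub>R l = klein_matrix x *v v"
    by (simp add: vec_eq_iff klein_matrix_mult l_def fibre_deriv_alphaF[OF assms]
        klein_metric_commute[of x v])
  have l_v: "?\<alpha> = l \<bullet> v"
    using sum_fibre_deriv_axis[OF smooth_alphaF assms] liouville_alphaF[OF assms]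
    by (simp add: l_def inner_vec_def mult.commute)
  have "betaF x v = (\<Sum>i\<in>UNIV. v $ i * betaF x (?e i))"
    by (rule linear_eq_sum_axis[OF linear_betaF])
  then have "b \<bullet> v = betaF x v"
    by (simp add: b_def inner_vec_def mult.commute)
  then have F: "(l + b) \<bullet> v = FF x v"
    by (simp only: inner_add_left FF_def l_v[symmetric])
  have hessian: "fibre_deriv (?e i) (fibre_deriv (?e j) (case_prod alphaF)) (x, v)
      = (klein_matrix x $ i $ j - l $ i * l $ j) / ?\<alpha>" for i j
    using fibre_hessian_alphaF[OF assms, of "?e i" "?e j"] \<alpha>
    by (simp add: klein_matrix_def l_def nonzero_eq_divide_eq mult.commute)
  have fund_g: "fund_g FF i j x v = (l + b) $ i * (l + b) $ j
      + FF x v / ?\<alpha> * (klein_matrix x $ i $ j - l $ i * l $ j)" for i j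
    using fund_g_eq[OF open_slit_disc smooth_FF assms, of i j]
    by (simp add: fibre_hessian_FF[OF assms] fibre_deriv_FF[OF assms] hessian)
      (simp add: l_def b_def)
  show ?thesis
    unfolding fund_g F[symmetric]
    by (rule det_randers[OF _ \<alpha> gradient l_v]) (simp add: klein_matrix_def klein_metric_commute)
qed

interpretation funk: projectively_flat_surface slit_disc "case_prod FF" "case_prod funk_factor"
proof
  show "det (\<chi> i j. fund_g (curry (case_prod FF)) i j x v) \<noteq> 0" if "(x, v) \<in> slit_disc" for x v
    using FF_pos[OF that] alphaF_pos[OF that] gap_rK_pos[OF that] rK_bounds
    by (simp add: det_fund_g_FF[OF that] det_klein_matrix)
  show "base_deriv e (case_prod FF) p
      = fibre_deriv e (\<lambda>q. case_prod funk_factor q * case_prod FF q) p"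
    if "p \<in> slit_disc" for e p
    using that by (cases p) (simp only: base_deriv_FF)
qed (fact open_slit_disc smooth_FF smooth_funk_factor homogeneous_FF homogeneous_funk_factor
    FF_nonzero)+

lemma flat_spray_klein_factor:
  assumes "(x, v) \<in> slit_disc"
  shows "flat_spray (case_prod klein_factor) (x, v) = (alphaF x v)\<^sup>2 + (klein_factor x v)\<^sup>2"
  using gap_rK_pos[OF assms] unfolding alphaF_sq[OF assms]
  by (simp add: flat_spray_def dir_deriv_klein_factor[OF assms] klein_factor_def klein_metric_def
      divide_simps power2_eq_square algebra_simps)

lemma flat_spray_phiF:
  assumes "(x, v) \<in> slit_disc"
  shows "flat_spray (case_prod phiF) (x, v) = psiF x v + 4 * klein_factor x v * phiF x v"
  using gap_rK_pos[OF assms] gap_1_pos[OF assms]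
  by (simp add: flat_spray_def dir_deriv_phiF[OF assms] psiF_def klein_factor_def phiF_def
      power2_norm_eq_inner
      divide_simps) algebra

lemma curvature_factor_FF:
  assumes "(x, v) \<in> slit_disc"
  shows "funk.curvature_factor (x, v)
    = 3 * (phiF x v / (2 * FF x v))\<^sup>2 - psiF x v / (2 * FF x v) - (alphaF x v)\<^sup>2"
proof -
  let ?P = "case_prod funk_factor" and ?F = "case_prod FF"
  let ?p = "case_prod klein_factor" and ?\<phi> = "case_prod phiF"
  define q where "q = phiF x v / (2 * FF x v)"
  note smooth = smooth_on_mult[OF open_slit_disc smooth_klein_factor smooth_FF]
    smooth_on_mult[OF open_slit_disc smooth_on_const[OF open_slit_disc] smooth_phiF]
  have F: "FF x v \<noteq> 0" using FF_pos[OF assms] by simp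
  have P: "funk_factor x v = klein_factor x v + q" and \<phi>: "phiF x v = 2 * q * FF x v"
    using F by (simp_all add: funk_factor_def q_def)
  have "base_deriv v (\<lambda>p. ?P p * ?F p) (x, v) = base_deriv v (\<lambda>p. ?p p * ?F p + 1/2 * ?\<phi> p) (x, v)"
    by (intro dir_deriv_cong[OF open_slit_disc assms]) (auto simp: funk_factor_mult_FF)
  then have "funk_factor x v * flat_spray ?F (x, v) + flat_spray ?P (x, v) * FF x v
      = klein_factor x v * flat_spray ?F (x, v) + flat_spray ?p (x, v) * FF x v
        + flat_spray ?\<phi> (x, v) / 2"
    unfolding flat_spray_def dir_deriv_add[OF assms smooth]
      dir_deriv_mult[OF assms smooth_funk_factor smooth_FF]
          dir_deriv_mult[OF assms smooth_klein_factor smooth_FF]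
      dir_deriv_mult[OF assms smooth_on_const[OF open_slit_disc] smooth_phiF]
    by simp
  then have "flat_spray ?P (x, v) * FF x v
      = (flat_spray ?p (x, v) - 2 * q * (klein_factor x v + q)) * FF x v + flat_spray ?\<phi> (x, v) / 2"
    using funk.flat_spray_F[OF assms] by (simp add: P algebra_simps)
  then have "flat_spray ?P (x, v) = (alphaF x v)\<^sup>2 + (klein_factor x v)\<^sup>2
      - 2 * q * (klein_factor x v + q)
      + psiF x v / (2 * FF x v) + 4 * klein_factor x v * q"
    using F unfolding flat_spray_klein_factor[OF assms] flat_spray_phiF[OF assms] \<phi>
    by (simp add: field_simps)
  then show ?thesis
    unfolding funk.curvature_factor_def q_def[symmetric]
    by (simp add: P power2_eq_square algebra_simps)
qed

lemma klein_metric_betaF_alternating: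
  assumes "(x, v) \<in> slit_disc"
  shows "klein_metric x v v * betaF x e - betaF x v * klein_metric x v e
    = (1 - rK\<^sup>2) * ((x \<bullet> e) * (norm v)\<^sup>2 - (v \<bullet> e) * (x \<bullet> v)) / ((gap rK x)\<^sup>2 * gap 1 x)"
  using gap_rK_pos[OF assms] gap_1_pos[OF assms]
  by (simp add: klein_metric_def betaF_eq power2_norm_eq_inner divide_simps)
    (simp add: algebra_simps power2_eq_square)

lemma tauF_eq:
  assumes "(x, v) \<in> slit_disc"
  shows "tauF k x v = alphaF x v * (alphaF x v * pdxi k FF x v / FF x v - pdxi k alphaF x v)"
proof -
  let ?e = "axis k 1 :: real^2" and ?N = "(1 - rK\<^sup>2) * (x $ k * (norm v)\<^sup>2 - v $ k * (x \<bullet> v))"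
  have pdxi_alphaF: "pdxi k alphaF x v = fibre_deriv ?e (case_prod alphaF) (x, v)"
    by (simp add: pdxi_eq_fibre_deriv[OF open_slit_disc assms refl])
  have pdxi_FF: "pdxi k FF x v = pdxi k alphaF x v + betaF x ?e"
    by (simp add: pdxi_eq_fibre_deriv[OF open_slit_disc assms refl] pdxi_alphaF
        fibre_deriv_FF[OF assms])
  have "tauF k x v = ?N / ((gap rK x)\<^sup>2 * gap 1 x) / FF x v"
    by (simp add: tauF_def mult_ac)
  also have "?N / ((gap rK x)\<^sup>2 * gap 1 x)
      = alphaF x v * (alphaF x v * betaF x ?e - betaF x v * pdxi k alphaF x v)"
    using klein_metric_betaF_alternating[OF assms, of ?e]
    unfolding fibre_deriv_alphaF[OF assms, of ?e, symmetric] alphaF_sq[OF assms, symmetric]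
        pdxi_alphaF
    by (simp add: inner_axis algebra_simps power2_eq_square)
  also have "alphaF x v * betaF x ?e - betaF x v * pdxi k alphaF x v
      = alphaF x v * pdxi k FF x v - FF x v * pdxi k alphaF x v"
    by (simp add: pdxi_FF FF_def algebra_simps)
  finally show ?thesis
    using FF_pos[OF assms] by (simp add: diff_divide_distrib right_diff_distrib)
qed

theorem theorem4p2:
  fixes x v :: "real^2"
  assumes "norm x < rK" and "v \<noteq> 0"
  defines "\<phi> \<equiv> (1 - rK^2) * ((1 - (norm x)^2) * (norm v)^2 + 2 * (x \<bullet> v)^2)
                 / ((rK^2 - (norm x)^2) * (1 - (norm x)^2)^2)"
    and "\<psi> \<equiv> 2 * (1 - rK^2) * (x \<bullet> v) / ((1 - (norm x)^2)^3 * (rK^2 - (norm x)^2)^2)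
              * ((1 - (norm x)^2) * (norm v)^2 * (3 * rK^2 - 2 * (norm x)^2 - 1)
                 - 2 * (x \<bullet> v)^2 * (1 + (norm x)^2 - 2 * rK^2))"
    and "\<tau> \<equiv> \<lambda>k. (1 - rK^2) * (x $ k * (norm v)^2 - v $ k * (x \<bullet> v))
              / (FF x v * (rK^2 - (norm x)^2)^2 * (1 - (norm x)^2))"
  shows "(\<forall>i k. riemann FF i k x v =
            - ((if i = k then 1 else 0) * (alphaF x v)^2 - alphaF x v * pdxi k alphaF x v * v $ i)
            + (3 * (\<phi> / (2 * FF x v))^2 - \<psi> / (2 * FF x v))
              * ((if i = k then 1 else 0) - pdxi k FF x v / FF x v * v $ i)
            + \<tau> k * v $ i)
       \<and> ricci FF x v = 3 * (\<phi> / (2 * FF x v))^2 - \<psi> / (2 * FF x v) - (alphaF x v)^2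
       \<and> flag_curv FF x v * (FF x v)^2 = 3 * (\<phi> / (2 * FF x v))^2 - \<psi> / (2 * FF x v) - (alphaF x v)^2"
proof -
  have slit: "(x, v) \<in> slit_disc" using assms(1,2) by (simp add: slit_disc_def)
  define B where "B = 3 * (\<phi> / (2 * FF x v))\<^sup>2 - \<psi> / (2 * FF x v)"
  have "\<phi> = phiF x v" "\<psi> = psiF x v"
    by (simp_all add: \<phi>_def \<psi>_def phiF_def psiF_def gap_def algebra_simps)
  then have curvature: "funk.curvature_factor (x, v) = B - (alphaF x v)\<^sup>2"
    by (simp add: curvature_factor_FF[OF slit] B_def)
  have \<tau>: "\<tau> k = alphaF x v * (alphaF x v * pdxi k FF x v / FF x v - pdxi k alphaF x v)" for k
    unfolding tauF_eq[OF slit, symmetric] by (simp add: \<tau>_def tauF_def gap_def)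
  have "riemann FF i k x v = - ((if i = k then 1 else 0) * (alphaF x v)\<^sup>2
      - alphaF x v * pdxi k alphaF x v * v $ i)
      + B * ((if i = k then 1 else 0) - pdxi k FF x v / FF x v * v $ i) + \<tau> k * v $ i" for i k
    using funk.riemann_projectively_flat[OF slit, of i k] FF_pos[OF slit]
    by (simp add: curvature \<tau> power2_eq_square algebra_simps diff_divide_distrib)
  moreover have "ricci FF x v = B - (alphaF x v)\<^sup>2"
    using funk.ricci_projectively_flat[OF slit] by (simp add: curvature)
  moreover have "flag_curv FF x v * (FF x v)\<^sup>2 = ricci FF x v"
    using FF_pos[OF slit] by (simp add: flag_curv_def)
  ultimately show ?thesis
    unfolding B_def by simp
qed

end
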